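(* Let $L=L_K(E)$ be the Leavitt path algebra of an arbitrary graph $E$ over an arbitrary field $K$. The following are equivalent. (1) Every completely irreducible ideal of $L$ is graded. (2) Every prime ideal of $L$ is graded. (3) Every ideal of $L$ is graded. (4) The graph $E$ satisfies condition (K).
   Context: A graph $E=(E^0,E^1,r,s)$ is a directed graph: a nonempty set $E^0$ of vertices, a set $E^1$ of edges, and range and source maps $r,s:E^1\to E^0$ (no finiteness or countability assumptions). A vertex $v$ is regular if $s^{-1}(v)$ is finite and nonempty. For a field $K$, the Leavitt path algebra $L_K(E)$ is the (associative, not necessarily unital) $K$-algebra generated by $\{v\mid v\in E^0\}\cup\{e,e^*\mid e\in E^1\}$ subject to: $vw=\delta_{v,w}v$ for $v,w\in E^0$; $s(e)e=er(e)=e$ and $r(e)e^*=e^*s(e)=e^*$ for $e\in E^1$; $e^*f=\delta_{e,f}r(e)$ for $e,f\in E^1$; and $v=\sum_{e\in s^{-1}(v)}ee^*$ for every regular $v\in E^0$. A path is a finite sequence $\mu=e_1\cdots e_n$ of edges with $r(e_i)=s(e_{i+1})$; $s(\mu)=s(e_1)$, $r(\mu)=r(e_n)$, $|\mu|=n$; vertices are paths of length $0$; $\mu^*=e_n^*\cdots e_1^*$. $L$ is $\mathbb Z$-graded with $L_n$ the $K$-span of the elements $\mu\nu^*$ with $\mu,\nu$ paths and $|\mu|-|\nu|=n$; an ideal $I$ is graded if $I=\bigoplus_n(I\cap L_n)$. A closed path is a path $e_1\cdots e_n$ ($n\ge1$) with $r(e_n)=s(e_1)$. The graph satisfies condition (K)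 if any vertex on a closed path $\mu$ is also the source of a closed path different from $\mu$ (i.e. having a different set of edges). "Ideal" means two-sided ideal; products of ideals consist of finite sums of products. A prime ideal is a proper ideal $P$ such that $IJ\subseteq P$ implies $I\subseteq P$ or $J\subseteq P$ for all ideals $I,J$. A proper ideal $I$ is completely irreducible if it is not the intersection of any set of ideals properly containing $I$. *)

theory Defs
  imports
    "HOL-Library.Poly_Mapping"
    "HOL-Algebra.QuotRing"
    "HOL-Algebra.Ideal_Product"
    "HOL-Algebra.Module"
    "Graph_Theory.Arc_Walk"
begin

section \<open>Ideals of rings that need not have a unit\<close>

text \<open>
  The locale \<open>ideal\<close> of HOL-Algebra presupposes a unital ring, whereas a Leavitt path algebra has
  a unit only if the graph has finitely many vertices. The notions below never
  refer to the field \<open>one\<close> of the record, which is a junk value for all the algebras of this theory.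
  Scalars are taken from a type of class \<open>field\<close>.
\<close>

definition rng_ideal :: "'x set \<Rightarrow> ('x, 'm) ring_scheme \<Rightarrow> bool" where
  "rng_ideal I R \<longleftrightarrow> additive_subgroup I R \<and>
     (\<forall>a\<in>I. \<forall>x\<in>carrier R. x \<otimes>\<^bsub>R\<^esub> a \<in> I \<and> a \<otimes>\<^bsub>R\<^esub> x \<in> I)"

definition rng_prime_ideal :: "'x set \<Rightarrow> ('x, 'm) ring_scheme \<Rightarrow> bool" where
  "rng_prime_ideal P R \<longleftrightarrow> rng_ideal P R \<and> P \<noteq> carrier R \<and>
     (\<forall>I J. rng_ideal I R \<longrightarrow> rng_ideal J R \<longrightarrow> I \<cdot>\<^bsub>R\<^esub> J \<subseteq> P \<longrightarrow> I \<subseteq> P \<or> J \<subseteq> P)"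

text \<open>The intersection with the carrier makes the intersection of the empty family the whole ring.\<close>

definition completely_irreducible_ideal :: "'x set \<Rightarrow> ('x, 'm) ring_scheme \<Rightarrow> bool" where
  "completely_irreducible_ideal I R \<longleftrightarrow> rng_ideal I R \<and> I \<noteq> carrier R \<and>
     \<not> (\<exists>\<S>. (\<forall>J\<in>\<S>. rng_ideal J R \<and> I \<subset> J) \<and> I = carrier R \<inter> \<Inter>\<S>)"

definition alg_subspace :: "'x set \<Rightarrow> ('k::field, 'x, 'm) module_scheme \<Rightarrow> bool" where
  "alg_subspace S A \<longleftrightarrow> additive_subgroup S A \<and> (\<forall>k. \<forall>x\<in>S. k \<odot>\<^bsub>A\<^esub> x \<in> S)"

definition alg_span :: "('k::field, 'x, 'm) module_scheme \<Rightarrow> 'x set \<Rightarrow> 'x set" where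
  "alg_span A X = (\<lambda>S. alg_subspace S A) hull X"

definition alg_ideal_generated :: "('k::field, 'x, 'm) module_scheme \<Rightarrow> 'x set \<Rightarrow> 'x set" where
  "alg_ideal_generated A X = (\<lambda>I. rng_ideal I A \<and> alg_subspace I A) hull X"

definition quotient_alg ::
    "('k::field, 'x, 'm) module_scheme \<Rightarrow> 'x set \<Rightarrow> ('k, 'x set) module" where
  "quotient_alg A I =
     \<lparr> carrier = carrier (A Quot I), mult = mult (A Quot I), one = one (A Quot I),
       zero = zero (A Quot I), add = add (A Quot I),
       smult = (\<lambda>k X. \<Union>x\<in>X. I +>\<^bsub>A\<^esub> (k \<odot>\<^bsub>A\<^esub> x)) \<rparr>"

text \<open>\<open>S\<close> is the internal direct sum of the family \<open>C\<close>.\<close>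

definition direct_sum_of :: "('x, 'm) ring_scheme \<Rightarrow> 'x set \<Rightarrow> ('i \<Rightarrow> 'x set) \<Rightarrow> bool" where
  "direct_sum_of R S C \<longleftrightarrow> (\<forall>n. C n \<subseteq> S) \<and>
     (\<forall>x\<in>S. \<exists>!c. (\<forall>n. c n \<in> C n) \<and> finite {n. c n \<noteq> \<zero>\<^bsub>R\<^esub>} \<and>
        x = finsum R c {n. c n \<noteq> \<zero>\<^bsub>R\<^esub>})"


section \<open>Free associative algebras without unit\<close>

instantiation list :: (type) monoid_add
begin
definition zero_list :: "'a list" where "zero_list = []"
definition plus_list :: "'a list \<Rightarrow> 'a list \<Rightarrow> 'a list" where "plus_list = (@)"
instance by standard (simp_all add: zero_list_def plus_list_def)
end

text \<open>
  With concatenation as addition of words, the multiplication of \<^typ>\<open>'g list \<Rightarrow>\<^sub>0 'k\<close> is that of the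
  free unital algebra; excluding the empty word yields the free algebra without unit.
\<close>

definition free_alg :: "'g set \<Rightarrow> ('k::field, 'g list \<Rightarrow>\<^sub>0 'k) module" where
  "free_alg X =
     \<lparr> carrier = {f. \<forall>w\<in>Poly_Mapping.keys f. w \<noteq> [] \<and> set w \<subseteq> X},
       mult = (*), one = 1, zero = 0, add = (+),
       smult = (\<lambda>k. Poly_Mapping.map ((*) k)) \<rparr>"


section \<open>Leavitt path algebras\<close>

text \<open>The source and range maps of a graph are \<open>tail\<close> and \<open>head\<close>; \<open>Ghost e\<close> stands for \<open>e\<^sup>*\<close>.\<close>

datatype ('a, 'b) lpa_gen = Vertex 'a | Edge 'b | Ghost 'b

definition lpa_gens :: "('a, 'b) pre_digraph \<Rightarrow> ('a, 'b) lpa_gen set" where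
  "lpa_gens E = Vertex ` verts E \<union> Edge ` arcs E \<union> Ghost ` arcs E"

definition regular_vertex :: "('a, 'b) pre_digraph \<Rightarrow> 'a \<Rightarrow> bool" where
  "regular_vertex E v \<longleftrightarrow> v \<in> verts E \<and> finite (out_arcs E v) \<and> out_arcs E v \<noteq> {}"

abbreviation word :: "'g list \<Rightarrow> 'g list \<Rightarrow>\<^sub>0 'k::field" where
  "word w \<equiv> Poly_Mapping.single w 1"

text \<open>A relation \<open>x = y\<close> is represented by the element \<open>x - y\<close> of the free algebra.\<close>

inductive_set lpa_relations :: "('a, 'b) pre_digraph \<Rightarrow> (('a, 'b) lpa_gen list \<Rightarrow>\<^sub>0 'k::field) set"
  for E where
  vertices: "\<lbrakk>v \<in> verts E; w \<in> verts E\<rbrakk> \<Longrightarrow>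
    word [Vertex v] * word [Vertex w] - (if v = w then word [Vertex v] else 0) \<in> lpa_relations E"
| source_edge: "e \<in> arcs E \<Longrightarrow>
    word [Vertex (tail E e)] * word [Edge e] - word [Edge e] \<in> lpa_relations E"
| edge_range: "e \<in> arcs E \<Longrightarrow>
    word [Edge e] * word [Vertex (head E e)] - word [Edge e] \<in> lpa_relations E"
| range_ghost: "e \<in> arcs E \<Longrightarrow>
    word [Vertex (head E e)] * word [Ghost e] - word [Ghost e] \<in> lpa_relations E"
| ghost_source: "e \<in> arcs E \<Longrightarrow>
    word [Ghost e] * word [Vertex (tail E e)] - word [Ghost e] \<in> lpa_relations E"
| CK1: "\<lbrakk>e \<in> arcs E; f \<in> arcs E\<rbrakk> \<Longrightarrow>
    word [Ghost e] * word [Edge f] - (if e = f then word [Vertex (head E e)] else 0)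
      \<in> lpa_relations E"
| CK2: "regular_vertex E v \<Longrightarrow>
    word [Vertex v] - (\<Sum>e\<in>out_arcs E v. word [Edge e] * word [Ghost e]) \<in> lpa_relations E"

definition lpa_ideal :: "('a, 'b) pre_digraph \<Rightarrow> (('a, 'b) lpa_gen list \<Rightarrow>\<^sub>0 'k::field) set" where
  "lpa_ideal E = alg_ideal_generated (free_alg (lpa_gens E)) (lpa_relations E)"

definition leavitt_path_algebra ::
    "('a, 'b) pre_digraph \<Rightarrow> ('k::field, (('a, 'b) lpa_gen list \<Rightarrow>\<^sub>0 'k) set) module" where
  "leavitt_path_algebra E = quotient_alg (free_alg (lpa_gens E)) (lpa_ideal E)"

text \<open>The image in the Leavitt path algebra of a product of generators.\<close>

definition lpa_word ::
    "('a, 'b) pre_digraph \<Rightarrow> ('a, 'b) lpa_gen list \<Rightarrow> (('a, 'b) lpa_gen list \<Rightarrow>\<^sub>0 'k::field) set" where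
  "lpa_word E w = lpa_ideal E +>\<^bsub>free_alg (lpa_gens E)\<^esub> word w"

text \<open>
  A path is a pair of its source and its list of edges, so that \<open>(v, [])\<close> is the path \<open>v\<close> of length 0.
\<close>

definition paths :: "('a, 'b) pre_digraph \<Rightarrow> ('a \<times> 'b list) set" where
  "paths E = {(u, p). \<exists>v. pre_digraph.awalk E u p v}"

fun path_word :: "'a \<times> 'b list \<Rightarrow> ('a, 'b) lpa_gen list" where
  "path_word (u, p) = (if p = [] then [Vertex u] else map Edge p)"

fun ghost_word :: "'a \<times> 'b list \<Rightarrow> ('a, 'b) lpa_gen list" where
  "ghost_word (u, p) = (if p = [] then [Vertex u] else map Ghost (rev p))"

definition lpa_component ::
    "('a, 'b) pre_digraph \<Rightarrow> int \<Rightarrow> (('a, 'b) lpa_gen list \<Rightarrow>\<^sub>0 'k::field) set set" where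
  "lpa_component E n = alg_span (leavitt_path_algebra E)
     {lpa_word E (path_word \<mu>) \<otimes>\<^bsub>leavitt_path_algebra E\<^esub> lpa_word E (ghost_word \<nu>) | \<mu> \<nu>.
        \<mu> \<in> paths E \<and> \<nu> \<in> paths E \<and> int (length (snd \<mu>)) - int (length (snd \<nu>)) = n}"

definition lpa_graded ::
    "('a, 'b) pre_digraph \<Rightarrow> (('a, 'b) lpa_gen list \<Rightarrow>\<^sub>0 'k::field) set set \<Rightarrow> bool" where
  "lpa_graded E I \<longleftrightarrow>
     direct_sum_of (leavitt_path_algebra E) I (\<lambda>n. I \<inter> lpa_component E n)"


section \<open>Condition (K)\<close>

definition closed_path_at :: "('a, 'b) pre_digraph \<Rightarrow> 'a \<Rightarrow> 'b list \<Rightarrow> bool" where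
  "closed_path_at E v p \<longleftrightarrow> p \<noteq> [] \<and> pre_digraph.awalk E v p v"

definition condition_K :: "('a, 'b) pre_digraph \<Rightarrow> bool" where
  "condition_K E \<longleftrightarrow>
     (\<forall>u p. closed_path_at E u p \<longrightarrow>
        (\<forall>v\<in>set (pre_digraph.awalk_verts E u p). \<exists>q. closed_path_at E v q \<and> set q \<noteq> set p))"

end

theory Submission
  imports Defs "HOL-Library.Sublist"
begin

text \<open>
  The implications from all ideals to prime and to completely irreducible ideals are immediate, so
  there are three things to show.

  Completely irreducible to all ideals. If \<open>f\<close> lies in an ideal \<open>I\<close> and one of its
  homogeneous parts \<open>a\<close> does not, then by Zorn's lemma some ideal containing \<open>I\<close> is maximal among those that
  avoid \<open>a\<close>. It is completely irreducible, because \<open>a\<close> lies in every larger ideal; it is not graded,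
  because it contains \<open>f\<close> but not \<open>a\<close> (\<open>completely_irreducible_graded_imp_graded\<close>).

  Condition (K) to all ideals. Let \<open>J\<close> be the largest graded ideal inside an ideal \<open>I\<close>, so that
  every homogeneous element of \<open>I\<close> lies in \<open>J\<close>, and suppose that \<open>x\<close> is in \<open>I\<close> but not in
  \<open>J\<close>. The heart of the matter is that \<open>x\<close> can be multiplied on the right by some edge without
  falling into \<open>J\<close> (\<open>not_stuck\<close>): if all products \<open>x e\<close> were in \<open>J\<close>, then the negative
  parts of \<open>x\<close> would be in \<open>J\<close>, since an element \<open>f\<close> of negative degree is a finite sum of terms
  \<open>f e e\<^sup>*\<close>; passing to the elements \<open>e\<^sup>* x\<close>, which have smaller degrees, the positive parts are in
  \<open>J\<close> as well, so that \<open>x\<close> would be congruent to its part of degree 0, a homogeneous element of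
  \<open>I\<close>. This argument treats infinite emitters and breaking vertices like all other vertices.
  Multiplying by a long path removes all ghost edges from \<open>x\<close>, and removing a shortest
  path from the left leaves \<open>k v + \<Sum> k\<^sub>i p\<^sub>i\<close> in \<open>I\<close>, with \<open>k \<noteq> 0\<close> and closed paths
  \<open>p\<^sub>i\<close> at \<open>v\<close>. By condition (K) there is for every closed path \<open>p\<close> at \<open>v\<close> a closed
  path \<open>q\<close> at \<open>v\<close> that is not a prefix of \<open>p q\<close>, so that \<open>q\<^sup>* p q = 0\<close> while
  \<open>q\<^sup>* v q = v\<close>. Sandwiching between such \<open>q\<^sup>*\<close> and \<open>q\<close> kills the \<open>p\<^sub>i\<close> one after the
  other (\<open>vertex_in_if_closed_sum\<close>). In the end \<open>v\<close> lies in \<open>I\<close>, hence in \<open>J\<close>, and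
  then so does the ghost-free multiple of \<open>x\<close>, a contradiction.

  Prime ideals to condition (K). If (K) fails, then there is a cycle \<open>c\<close> at a vertex \<open>v\<close> such that all closed
  paths at \<open>v\<close> run through the edges of \<open>c\<close> only. Let the algebra act on the infinite paths that end in
  \<open>ccc\<dots>\<close>, edges by prepending and ghost edges by removing the first edge. The infinite path
  \<open>ccc\<dots>\<close> is the only one of these that starts at \<open>v\<close>, and \<open>c\<close> fixes it; so \<open>c - v\<close> annihilates
  the module but its degree-0 part \<open>- v\<close> does not, and the annihilator is not graded. It is prime
  because every ideal that does not annihilate the module contains an element that sends
  \<open>ccc\<dots>\<close> to a nonzero multiple of itself (\<open>isolate_cycle\<close>), and so do products of such
  elements.

  All computations take place in the free algebra: ideals of the Leavitt path algebra are replaced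
  by their preimages, and equality by congruence modulo the ideal of relations.
\<close>

section \<open>The free algebra and its ideals\<close>

lemma poly_mapping_sum_singles:
  "(f :: 'w \<Rightarrow>\<^sub>0 'c::comm_monoid_add)
     = (\<Sum>w\<in>Poly_Mapping.keys f. Poly_Mapping.single w (Poly_Mapping.lookup f w))"
  by (rule poly_mapping_eqI)
    (simp add: lookup_sum lookup_single when_def in_keys_iff if_distrib cong: if_cong)

lemma poly_mapping_span_induct:
  assumes "P 0" and "\<And>f g. P f \<Longrightarrow> P g \<Longrightarrow> P (f + g)"
    and "\<And>w c. w \<in> Poly_Mapping.keys f \<Longrightarrow> P (Poly_Mapping.single w c)"
  shows "P (f :: 'w \<Rightarrow>\<^sub>0 'c::comm_monoid_add)"
proof -
  have "P (\<Sum>w\<in>A. Poly_Mapping.single w (Poly_Mapping.lookup f w))"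
    if "finite A" "A \<subseteq> Poly_Mapping.keys f" for A
    using that by (induction rule: finite_induct) (simp_all add: assms)
  from this[of "Poly_Mapping.keys f"] show ?thesis
    by (simp add: poly_mapping_sum_singles[symmetric])
qed

lemma single_list_mult [simp]:
  "Poly_Mapping.single u a * Poly_Mapping.single v b = Poly_Mapping.single (u @ v) (a * b :: 'k::field)"
  by (simp add: mult_single plus_list_def)

lemma keys_subset_mult:
  "Poly_Mapping.keys (f * g) \<subseteq>
    {u @ v | u v. u \<in> Poly_Mapping.keys f \<and> v \<in> Poly_Mapping.keys (g :: 'g list \<Rightarrow>\<^sub>0 'k::field)}"
  using keys_mult[of f g] by (simp add: plus_list_def)

lemma word_Nil [simp]: "word ([] :: 'g list) = 1"
  using single_one[where 'a="'g list"] by (simp add: zero_list_def)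

lemma carrier_free_alg: "carrier (free_alg X) = {f. \<forall>w\<in>Poly_Mapping.keys f. w \<noteq> [] \<and> set w \<subseteq> X}"
  by (simp add: free_alg_def)

lemma free_alg_sel [simp]:
  "mult (free_alg X) = (*)" "zero (free_alg X) = 0" "add (free_alg X) = (+)"
  "smult (free_alg X) k f = Poly_Mapping.single [] k * f"
  by (simp_all add: free_alg_def mult_map_scale_conv_mult zero_list_def)

lemma zero_in_free [simp]: "0 \<in> carrier (free_alg X)"
  by (simp add: carrier_free_alg)

lemma add_in_free [simp]:
  "f \<in> carrier (free_alg X) \<Longrightarrow> g \<in> carrier (free_alg X) \<Longrightarrow> f + g \<in> carrier (free_alg X)"
  using keys_add[of f g] by (auto simp: carrier_free_alg)

lemma uminus_in_free [simp]: "f \<in> carrier (free_alg X) \<Longrightarrow> - f \<in> carrier (free_alg X)"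
  by (auto simp: carrier_free_alg in_keys_iff)

lemma diff_in_free [simp]:
  "f \<in> carrier (free_alg X) \<Longrightarrow> g \<in> carrier (free_alg X) \<Longrightarrow> f - g \<in> carrier (free_alg X)"
  using add_in_free[of f X "- g"] by simp

lemma mult_in_free [simp]:
  assumes "f \<in> carrier (free_alg X)" "g \<in> carrier (free_alg X)"
  shows "f * g \<in> carrier (free_alg X)"
proof -
  have "w \<noteq> [] \<and> set w \<subseteq> X" if w: "w \<in> Poly_Mapping.keys (f * g)" for w
  proof -
    obtain u v where "w = u @ v" "u \<in> Poly_Mapping.keys f" "v \<in> Poly_Mapping.keys g"
      using subsetD[OF keys_subset_mult w] by blast
    then show ?thesis using assms by (auto simp: carrier_free_alg)
  qed
  then show ?thesis by (auto simp: carrier_free_alg)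
qed

lemma single_in_free [simp]:
  "w \<noteq> [] \<Longrightarrow> set w \<subseteq> X \<Longrightarrow> Poly_Mapping.single w c \<in> carrier (free_alg X)"
  by (auto simp: carrier_free_alg)

lemma scale_in_free [simp]:
  assumes "f \<in> carrier (free_alg X)"
  shows "Poly_Mapping.single [] k * f \<in> carrier (free_alg X)"
  using assms by (auto simp: carrier_free_alg dest!: subsetD[OF keys_subset_mult] split: if_splits)

lemma sum_in_free [simp]:
  "(\<And>i. i \<in> A \<Longrightarrow> f i \<in> carrier (free_alg X)) \<Longrightarrow> sum f A \<in> carrier (free_alg X)"
  by (induction A rule: infinite_finite_induct) auto

lemma free_span_induct [consumes 1, case_names zero add single]:
  assumes "f \<in> carrier (free_alg X)" "P 0" "\<And>f g. P f \<Longrightarrow> P g \<Longrightarrow> P (f + g)"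
    and "\<And>w c. w \<noteq> [] \<Longrightarrow> set w \<subseteq> X \<Longrightarrow> P (Poly_Mapping.single w c)"
  shows "P f"
proof (rule poly_mapping_span_induct[of P])
  show "P (Poly_Mapping.single w c)" if "w \<in> Poly_Mapping.keys f" for w c
    using assms(1,4) that by (auto simp: carrier_free_alg)
qed (fact assms)+

lemma abelian_group_free_alg: "abelian_group (free_alg X)"
proof (rule abelian_groupI)
  fix f :: "'a list \<Rightarrow>\<^sub>0 'b" assume "f \<in> carrier (free_alg X)"
  then show "\<exists>g\<in>carrier (free_alg X). g \<oplus>\<^bsub>free_alg X\<^esub> f = \<zero>\<^bsub>free_alg X\<^esub>"
    by (intro bexI[of _ "- f"]) auto
qed (auto simp: add.assoc add.commute)

lemma additive_subgroup_free_alg: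
  "additive_subgroup S (free_alg X) \<longleftrightarrow>
     S \<subseteq> carrier (free_alg X) \<and> 0 \<in> S \<and> (\<forall>f\<in>S. \<forall>g\<in>S. f - g \<in> S)"
proof -
  interpret abelian_group "free_alg X" by (rule abelian_group_free_alg)
  have inv: "\<ominus>\<^bsub>free_alg X\<^esub> f = - f" if "f \<in> carrier (free_alg X)" for f
    using that by (intro minus_equality) auto
  show ?thesis
  proof (intro iffI conjI)
    assume "additive_subgroup S (free_alg X)"
    then interpret S: additive_subgroup S "free_alg X" .
    show "S \<subseteq> carrier (free_alg X)" by (rule S.a_subset)
    show "0 \<in> S" using S.zero_closed by simp
    show "\<forall>f\<in>S. \<forall>g\<in>S. f - g \<in> S"
    proof (intro ballI)
      fix f g assume "f \<in> S" "g \<in> S"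
      moreover from this have "\<ominus>\<^bsub>free_alg X\<^esub> g \<in> S" using S.a_inv_closed by blast
      moreover have "\<ominus>\<^bsub>free_alg X\<^esub> g = - g" using \<open>g \<in> S\<close> S.a_subset by (intro inv) blast
      ultimately show "f - g \<in> S" using S.a_closed[of f "- g"] by simp
    qed
  next
    assume A: "S \<subseteq> carrier (free_alg X) \<and> 0 \<in> S \<and> (\<forall>f\<in>S. \<forall>g\<in>S. f - g \<in> S)"
    then have d: "f - g \<in> S" if "f \<in> S" "g \<in> S" for f g using that by blast
    have m: "- f \<in> S" if "f \<in> S" for f using d[of 0 f] A that by simp
    have "f + g \<in> S" if "f \<in> S" "g \<in> S" for f g
      using d[of f "- g"] that m by simp
    moreover have "inv\<^bsub>add_monoid (free_alg X)\<^esub> f \<in> S" if "f \<in> S" for f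
    proof -
      have "inv\<^bsub>add_monoid (free_alg X)\<^esub> f = - f" using A that by (subst inv[symmetric]) (auto simp: a_inv_def)
      then show ?thesis using m[OF that] by simp
    qed
    ultimately show "additive_subgroup S (free_alg X)"
      using A by (intro additive_subgroup.intro subgroup.intro) auto
  qed
qed

text \<open>
  The same notion as \<open>rng_ideal\<close> of the free algebra, in terms of the type class operations
  (\<open>rng_ideal_free_alg\<close>).
\<close>

definition free_ideal :: "'g set \<Rightarrow> ('g list \<Rightarrow>\<^sub>0 'k::field) set \<Rightarrow> bool" where
  "free_ideal X S \<longleftrightarrow> S \<subseteq> carrier (free_alg X) \<and> 0 \<in> S \<and> (\<forall>f\<in>S. \<forall>g\<in>S. f - g \<in> S) \<and>
     (\<forall>f\<in>S. \<forall>g\<in>carrier (free_alg X). g * f \<in> S \<and> f * g \<in> S)"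

lemma rng_ideal_free_alg: "rng_ideal S (free_alg X) \<longleftrightarrow> free_ideal X S"
  unfolding rng_ideal_def free_ideal_def additive_subgroup_free_alg free_alg_sel by (simp only: conj_assoc)

context
  fixes X :: "'g set" and S :: "('g list \<Rightarrow>\<^sub>0 'k::field) set"
  assumes S: "free_ideal X S"
begin

lemma free_ideal_carrier: "f \<in> S \<Longrightarrow> f \<in> carrier (free_alg X)"
  and free_ideal_zero: "0 \<in> S"
  and free_ideal_diff: "f \<in> S \<Longrightarrow> g \<in> S \<Longrightarrow> f - g \<in> S"
  and free_ideal_lmult: "f \<in> S \<Longrightarrow> g \<in> carrier (free_alg X) \<Longrightarrow> g * f \<in> S"
  and free_ideal_rmult: "f \<in> S \<Longrightarrow> g \<in> carrier (free_alg X) \<Longrightarrow> f * g \<in> S"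
  using S by (auto simp: free_ideal_def)

lemma free_ideal_uminus: "f \<in> S \<Longrightarrow> - f \<in> S"
  using free_ideal_diff[OF free_ideal_zero, of f] by simp

lemma free_ideal_add: "f \<in> S \<Longrightarrow> g \<in> S \<Longrightarrow> f + g \<in> S"
  using free_ideal_diff[of f "- g"] free_ideal_uminus[of g] by simp

lemma free_ideal_sum: "(\<And>i. i \<in> A \<Longrightarrow> f i \<in> S) \<Longrightarrow> sum f A \<in> S"
  by (induction A rule: infinite_finite_induct) (auto intro: free_ideal_zero free_ideal_add)

text \<open>
  The free algebra has no unit; multiplication by the empty word is nevertheless harmless.
\<close>

lemma free_ideal_word_lmult: "f \<in> S \<Longrightarrow> set u \<subseteq> X \<Longrightarrow> word u * f \<in> S"
  by (cases "u = []") (auto intro: free_ideal_lmult)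

lemma free_ideal_word_rmult: "f \<in> S \<Longrightarrow> set u \<subseteq> X \<Longrightarrow> f * word u \<in> S"
  by (cases "u = []") (auto intro: free_ideal_rmult)

lemma free_ideal_transfer: "f - g \<in> S \<Longrightarrow> g \<in> S \<Longrightarrow> f \<in> S"
  using free_ideal_add[of "f - g" g] by simp

lemma free_ideal_transfer': "f - g \<in> S \<Longrightarrow> f \<in> S \<Longrightarrow> g \<in> S"
  using free_ideal_diff[of f "f - g"] by simp

lemma free_ideal_trans: "f - g \<in> S \<Longrightarrow> g - h \<in> S \<Longrightarrow> f - h \<in> S"
  using free_ideal_add[of "f - g" "g - h"] by simp

lemma free_ideal_sym: "f - g \<in> S \<Longrightarrow> g - f \<in> S"
  using free_ideal_uminus[of "f - g"] by simp

end

section \<open>The grading of the free algebra\<close>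

lemma alg_subspace_free_alg:
  "alg_subspace S (free_alg X) \<longleftrightarrow> additive_subgroup S (free_alg X) \<and>
     (\<forall>k. \<forall>f\<in>S. Poly_Mapping.single [] k * f \<in> S)"
  by (simp add: alg_subspace_def)

primrec gen_deg :: "('a, 'b) lpa_gen \<Rightarrow> int" where
  "gen_deg (Vertex v) = 0"
| "gen_deg (Edge e) = 1"
| "gen_deg (Ghost e) = - 1"

definition word_deg :: "('a, 'b) lpa_gen list \<Rightarrow> int" where
  "word_deg w = sum_list (map gen_deg w)"

lemma word_deg_simps [simp]:
  "word_deg [] = 0" "word_deg (g # w) = gen_deg g + word_deg w"
  "word_deg (u @ w) = word_deg u + word_deg w"
  by (simp_all add: word_deg_def)

lemma word_deg_map [simp]:
  "word_deg (map Edge p) = int (length p)" "word_deg (map Ghost p) = - int (length p)"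
  by (induction p) simp_all

text \<open>
  The projection onto the component of degree \<open>n\<close> of the free algebra.
\<close>

definition hpart :: "int \<Rightarrow> (('a, 'b) lpa_gen list \<Rightarrow>\<^sub>0 'k::field) \<Rightarrow> ('a, 'b) lpa_gen list \<Rightarrow>\<^sub>0 'k" where
  "hpart n = Poly_Mapping.mapp (\<lambda>w c. c when word_deg w = n)"

lemma lookup_hpart: "Poly_Mapping.lookup (hpart n f) w = (Poly_Mapping.lookup f w when word_deg w = n)"
  by (auto simp: hpart_def lookup_mapp when_def in_keys_iff)

lemma keys_hpart: "Poly_Mapping.keys (hpart n f) = {w \<in> Poly_Mapping.keys f. word_deg w = n}"
  by (auto simp: in_keys_iff lookup_hpart)

lemma hpart_zero [simp]: "hpart n 0 = 0"
  and hpart_add: "hpart n (f + g) = hpart n f + hpart n g"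
  and hpart_diff: "hpart n (f - g) = hpart n f - hpart n g"
  by (rule poly_mapping_eqI; simp add: lookup_hpart lookup_add lookup_minus when_def)+

lemma hpart_sum: "hpart n (sum f A) = (\<Sum>i\<in>A. hpart n (f i))"
  by (induction A rule: infinite_finite_induct) (simp_all add: hpart_add)

lemma hpart_single [simp]:
  "hpart n (Poly_Mapping.single w c) = (if word_deg w = n then Poly_Mapping.single w c else 0)"
  by (rule poly_mapping_eqI) (auto simp: lookup_hpart lookup_single when_def)

lemma hpart_hpart [simp]: "hpart n (hpart m f) = (if n = m then hpart n f else 0)"
  by (rule poly_mapping_eqI) (auto simp: lookup_hpart when_def)

lemma hpart_eq_0: "n \<notin> word_deg ` Poly_Mapping.keys f \<Longrightarrow> hpart n f = 0"
  by (rule poly_mapping_eqI) (auto simp: lookup_hpart when_def in_keys_iff)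

lemma hpart_in_free [simp]: "f \<in> carrier (free_alg X) \<Longrightarrow> hpart n f \<in> carrier (free_alg X)"
  by (auto simp: carrier_free_alg keys_hpart)

lemma hpart_single_mult: "hpart n (Poly_Mapping.single u c * f) = Poly_Mapping.single u c * hpart (n - word_deg u) f"
proof (rule poly_mapping_span_induct[of _ f])
  show "hpart n (Poly_Mapping.single u c * Poly_Mapping.single w d) =
        Poly_Mapping.single u c * hpart (n - word_deg u) (Poly_Mapping.single w d)" for w and d :: 'c
    by auto
qed (simp_all add: hpart_add distrib_left)

lemma hpart_mult_single: "hpart n (f * Poly_Mapping.single u c) = hpart (n - word_deg u) f * Poly_Mapping.single u c"
proof (rule poly_mapping_span_induct[of _ f])
  show "hpart n (Poly_Mapping.single w d * Poly_Mapping.single u c) =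
        hpart (n - word_deg u) (Poly_Mapping.single w d) * Poly_Mapping.single u c" for w and d :: 'c
    by auto
qed (simp_all add: hpart_add distrib_right)

lemma sum_hpart: "finite D \<Longrightarrow> word_deg ` Poly_Mapping.keys f \<subseteq> D \<Longrightarrow> (\<Sum>n\<in>D. hpart n f) = f"
  by (rule poly_mapping_eqI)
    (auto simp: lookup_sum lookup_hpart when_def in_keys_iff subset_eq image_iff)

text \<open>
  For an ideal \<open>S\<close>, this is the largest graded ideal contained in \<open>S\<close>.
\<close>

definition graded_core ::
    "(('a, 'b) lpa_gen list \<Rightarrow>\<^sub>0 'k::field) set \<Rightarrow> (('a, 'b) lpa_gen list \<Rightarrow>\<^sub>0 'k) set" where
  "graded_core S = {f \<in> S. \<forall>n. hpart n f \<in> S}"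

lemma hpart_graded_core: "free_ideal X S \<Longrightarrow> f \<in> graded_core S \<Longrightarrow> hpart n f \<in> graded_core S"
  by (auto simp: graded_core_def free_ideal_zero)

lemma free_ideal_graded_core:
  fixes S :: "(('a, 'b) lpa_gen list \<Rightarrow>\<^sub>0 'k::field) set"
  assumes S: "free_ideal X S"
  shows "free_ideal X (graded_core S)"
  unfolding free_ideal_def
proof (intro conjI ballI)
  show "graded_core S \<subseteq> carrier (free_alg X)" "0 \<in> graded_core S"
    using S by (auto simp: graded_core_def free_ideal_zero free_ideal_def)
  show "f - g \<in> graded_core S" if "f \<in> graded_core S" "g \<in> graded_core S" for f g
    using that by (auto simp: graded_core_def hpart_diff intro: free_ideal_diff[OF S])
  fix f g :: "('a, 'b) lpa_gen list \<Rightarrow>\<^sub>0 'k"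
  assume f: "f \<in> graded_core S" and "g \<in> carrier (free_alg X)"
  from this(2) show "g * f \<in> graded_core S"
  proof (induction rule: free_span_induct)
    case (single w c)
    then show ?case using f
      by (auto simp: graded_core_def hpart_single_mult intro: free_ideal_lmult[OF S])
  qed (use S in \<open>auto simp: graded_core_def hpart_add distrib_right intro: free_ideal_zero free_ideal_add[OF S]\<close>)
  from \<open>g \<in> carrier (free_alg X)\<close> show "f * g \<in> graded_core S"
  proof (induction rule: free_span_induct)
    case (single w c)
    then show ?case using f
      by (auto simp: graded_core_def hpart_mult_single intro: free_ideal_rmult[OF S])
  qed (use S in \<open>auto simp: graded_core_def hpart_add distrib_left intro: free_ideal_zero free_ideal_add[OF S]\<close>)
qed

section \<open>The Leavitt path algebra as a quotient\<close>

text \<open>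
  The parameter \<open>K\<close> only serves to fix the type of the scalars.
\<close>

locale leavitt = wf_digraph E for E :: "('a, 'b) pre_digraph" +
  fixes K :: "'k::field itself"
begin

abbreviation "X \<equiv> lpa_gens E"
abbreviation F :: "(('a, 'b) lpa_gen list \<Rightarrow>\<^sub>0 'k) set" where "F \<equiv> carrier (free_alg X)"
abbreviation N :: "(('a, 'b) lpa_gen list \<Rightarrow>\<^sub>0 'k) set" where "N \<equiv> lpa_ideal E"
abbreviation L :: "('k, (('a, 'b) lpa_gen list \<Rightarrow>\<^sub>0 'k) set) module" where
  "L \<equiv> leavitt_path_algebra E"
abbreviation cl :: "(('a, 'b) lpa_gen list \<Rightarrow>\<^sub>0 'k) \<Rightarrow> (('a, 'b) lpa_gen list \<Rightarrow>\<^sub>0 'k) set" where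
  "cl f \<equiv> N +>\<^bsub>free_alg X\<^esub> f"

lemma gens_simps [simp]:
  "Vertex v \<in> X \<longleftrightarrow> v \<in> verts E" "Edge e \<in> X \<longleftrightarrow> e \<in> arcs E" "Ghost e \<in> X \<longleftrightarrow> e \<in> arcs E"
  by (auto simp: lpa_gens_def)

lemma gens_subset_simps [simp]:
  "Edge ` A \<subseteq> X \<longleftrightarrow> A \<subseteq> arcs E" "Ghost ` A \<subseteq> X \<longleftrightarrow> A \<subseteq> arcs E"
  by (auto simp: subset_eq)

lemma relations_in_F: "lpa_relations E \<subseteq> F"
proof
  fix f :: "('a, 'b) lpa_gen list \<Rightarrow>\<^sub>0 'k" assume "f \<in> lpa_relations E"
  then show "f \<in> F"
    by cases (auto intro!: diff_in_free sum_in_free simp: regular_vertex_def)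
qed

lemma N_free_ideal: "free_ideal X (N :: (('a, 'b) lpa_gen list \<Rightarrow>\<^sub>0 'k) set)"
  and N_scale: "f \<in> N \<Longrightarrow> Poly_Mapping.single [] (k :: 'k) * f \<in> N"
  and relations_in_N: "lpa_relations E \<subseteq> (N :: (('a, 'b) lpa_gen list \<Rightarrow>\<^sub>0 'k) set)"
proof -
  define T where "T = {S. (rng_ideal S (free_alg X) \<and> alg_subspace S (free_alg X)) \<and> lpa_relations E \<subseteq> (S :: (('a, 'b) lpa_gen list \<Rightarrow>\<^sub>0 'k) set)}"
  have N: "N = \<Inter>T" by (simp add: lpa_ideal_def alg_ideal_generated_def hull_def T_def)
  have "F \<in> T"
    using relations_in_F
    by (auto simp: T_def rng_ideal_free_alg free_ideal_def alg_subspace_free_alg additive_subgroup_free_alg)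
  have T: "free_ideal X S" "f \<in> S \<Longrightarrow> Poly_Mapping.single [] k * f \<in> S" "lpa_relations E \<subseteq> S" if "S \<in> T" for S f k
    using that by (auto simp: T_def rng_ideal_free_alg alg_subspace_free_alg)
  show "free_ideal X (N :: (('a, 'b) lpa_gen list \<Rightarrow>\<^sub>0 'k) set)"
    unfolding N using T(1) \<open>F \<in> T\<close> unfolding free_ideal_def by blast
  show "Poly_Mapping.single [] k * f \<in> N" if "f \<in> N" for f and k :: 'k
    using that T(2) unfolding N by blast
  show "lpa_relations E \<subseteq> (N :: (('a, 'b) lpa_gen list \<Rightarrow>\<^sub>0 'k) set)"
    using T(3) unfolding N by blast
qed

lemma N_minimal:
  assumes "free_ideal X S" "\<And>f k. f \<in> S \<Longrightarrow> Poly_Mapping.single [] k * f \<in> S" "lpa_relations E \<subseteq> S"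
  shows "N \<subseteq> S"
  unfolding lpa_ideal_def alg_ideal_generated_def
  using assms by (intro hull_minimal)
    (auto simp: rng_ideal_free_alg alg_subspace_free_alg additive_subgroup_free_alg free_ideal_def)

lemmas N_zero = free_ideal_zero[OF N_free_ideal]
  and N_add = free_ideal_add[OF N_free_ideal]
  and N_diff = free_ideal_diff[OF N_free_ideal]
  and N_uminus = free_ideal_uminus[OF N_free_ideal]
  and N_sum = free_ideal_sum[OF N_free_ideal]
  and N_trans = free_ideal_trans[OF N_free_ideal]
  and N_sym = free_ideal_sym[OF N_free_ideal]

text \<open>
  The relations are homogeneous, so the graded core of the ideal that they generate contains them
  all and cannot be smaller than this ideal.
\<close>

lemma N_hpart: 
  assumes "f \<in> N" shows "hpart n f \<in> N"
proof -
  have rel: "hpart n r \<in> N" if "r \<in> lpa_relations E" for n r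
  proof -
    from that have "\<exists>d. hpart n r = (if d = n then r else 0)"
    proof cases
      case (vertices v w)
      then show ?thesis by (auto simp: hpart_diff intro: exI[of _ 0])
    next
      case (source_edge e)
      then show ?thesis by (auto simp: hpart_diff intro: exI[of _ 1])
    next
      case (edge_range e)
      then show ?thesis by (auto simp: hpart_diff intro: exI[of _ 1])
    next
      case (range_ghost e)
      then show ?thesis by (auto simp: hpart_diff intro: exI[of _ "-1"])
    next
      case (ghost_source e)
      then show ?thesis by (auto simp: hpart_diff intro: exI[of _ "-1"])
    next
      case (CK1 e f)
      then show ?thesis by (auto simp: hpart_diff intro: exI[of _ 0])
    next
      case (CK2 v)
      then show ?thesis by (auto simp: hpart_diff hpart_sum intro: exI[of _ 0])
    qed
    then show ?thesis using relations_in_N that N_zero by (metis subsetD)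
  qed
  have "N \<subseteq> graded_core N"
    using N_scale rel relations_in_N
    by (intro N_minimal free_ideal_graded_core N_free_ideal)
      (auto simp: graded_core_def hpart_single_mult)
  then show ?thesis using assms by (auto simp: graded_core_def)
qed

lemma mem_cl: "h \<in> cl f \<longleftrightarrow> h - f \<in> N"
  by (auto simp: a_r_coset_def' intro!: bexI[of _ "h - f"])

lemma cl_eq_iff: "cl f = cl g \<longleftrightarrow> f - g \<in> N"
proof
  assume "cl f = cl g"
  then show "f - g \<in> N" using mem_cl[of f f] mem_cl[of f g] N_zero by simp
next
  assume fg: "f - g \<in> N"
  show "cl f = cl g"
    using N_trans[OF _ fg] N_trans[OF _ N_sym[OF fg]] by (auto simp: mem_cl)
qed

lemma carrier_L: "carrier L = cl ` F"
  by (auto simp: leavitt_path_algebra_def quotient_alg_def FactRing_def A_RCOSETS_def')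

lemma zero_L: "zero L = cl 0"
  by (auto simp: leavitt_path_algebra_def quotient_alg_def FactRing_def mem_cl)

lemma mult_L: 
  assumes "f \<in> F" "g \<in> F"
  shows "cl f \<otimes>\<^bsub>L\<^esub> cl g = cl (f * g)"
proof -
  have "cl (f' * g') = cl (f * g)" if "f' - f \<in> N" "g' - g \<in> N" for f' g'
  proof -
    have "f' = (f' - f) + f" by simp
    then have "f' \<in> F" using free_ideal_carrier[OF N_free_ideal that(1)] assms by (metis add_in_free)
    have "f' * g' - f * g = f' * (g' - g) + (f' - f) * g" by (simp add: algebra_simps)
    also have "\<dots> \<in> N"
      using that assms \<open>f' \<in> F\<close> by (intro N_add free_ideal_lmult[OF N_free_ideal] free_ideal_rmult[OF N_free_ideal])
    finally show ?thesis by (simp add: cl_eq_iff)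
  qed
  then have "cl (f' * g') = cl (f * g)" if "f' \<in> cl f" "g' \<in> cl g" for f' g'
    using that unfolding mem_cl by blast
  moreover have "f \<in> cl f" "g \<in> cl g" using N_zero by (simp_all add: mem_cl)
  ultimately have "(\<Union>f'\<in>cl f. \<Union>g'\<in>cl g. cl (f' * g')) = cl (f * g)" by blast
  then show ?thesis
    by (simp add: leavitt_path_algebra_def quotient_alg_def FactRing_def rcoset_mult_def)
qed

lemma add_L: "cl f \<oplus>\<^bsub>L\<^esub> cl g = cl (f + g)"
proof -
  have "cl f \<oplus>\<^bsub>L\<^esub> cl g = {f' + g' | f' g'. f' - f \<in> N \<and> g' - g \<in> N}"
    unfolding leavitt_path_algebra_def quotient_alg_def FactRing_def set_add_def'
    by (simp add: mem_cl[symmetric]) blast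
  also have "\<dots> = cl (f + g)"
  proof (intro equalityI subsetI)
    fix h assume "h \<in> {f' + g' | f' g'. f' - f \<in> N \<and> g' - g \<in> N}"
    then obtain f' g' where "h = f' + g'" "f' - f \<in> N" "g' - g \<in> N" by blast
    then show "h \<in> cl (f + g)" using N_add[of "f' - f" "g' - g"] by (simp add: mem_cl algebra_simps)
  next
    fix h assume "h \<in> cl (f + g)"
    then have "h = (h - g) + g" "h - g - f \<in> N" "g - g \<in> N"
      using N_zero by (auto simp: mem_cl algebra_simps)
    then show "h \<in> {f' + g' | f' g'. f' - f \<in> N \<and> g' - g \<in> N}" by blast
  qed
  finally show ?thesis .
qed

lemma smult_L: "k \<odot>\<^bsub>L\<^esub> cl f = cl (Poly_Mapping.single [] k * f)"
proof -
  have "cl (Poly_Mapping.single [] k * f') = cl (Poly_Mapping.single [] k * f)" if "f' - f \<in> N" for f'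
    using N_scale[OF that, of k] by (simp add: cl_eq_iff right_diff_distrib)
  then have "cl (Poly_Mapping.single [] k * f') = cl (Poly_Mapping.single [] k * f)" if "f' \<in> cl f" for f'
    using that unfolding mem_cl by blast
  moreover have "f \<in> cl f" using N_zero by (simp add: mem_cl)
  ultimately have "(\<Union>f'\<in>cl f. cl (Poly_Mapping.single [] k * f')) = cl (Poly_Mapping.single [] k * f)" by blast
  then show ?thesis
    by (simp add: leavitt_path_algebra_def quotient_alg_def)
qed

lemma abelian_group_L: "abelian_group L"
proof (rule abelian_groupI)
  fix a :: "(('a, 'b) lpa_gen list \<Rightarrow>\<^sub>0 'k) set" assume "a \<in> carrier L"
  then obtain f where "f \<in> F" "a = cl f" by (auto simp: carrier_L)
  then show "\<exists>b\<in>carrier L. b \<oplus>\<^bsub>L\<^esub> a = \<zero>\<^bsub>L\<^esub>"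
    by (intro bexI[of _ "cl (- f)"]) (auto simp: carrier_L add_L zero_L)
qed (auto simp: carrier_L add_L zero_L ac_simps)

lemma a_inv_L: "f \<in> F \<Longrightarrow> \<ominus>\<^bsub>L\<^esub> (cl f) = cl (- f)"
  by (rule abelian_group.minus_equality[OF abelian_group_L]) (auto simp: carrier_L add_L zero_L)

lemma finsum_L:
  assumes "finite A" "\<And>i. i \<in> A \<Longrightarrow> f i \<in> F"
  shows "finsum L (\<lambda>i. cl (f i)) A = cl (sum f A)"
proof -
  interpret abelian_group L by (rule abelian_group_L)
  show ?thesis using assms
  proof (induction rule: finite_induct)
    case empty
    then show ?case by (simp add: zero_L)
  next
    case (insert i A)
    then have "(\<lambda>i. cl (f i)) \<in> A \<rightarrow> carrier L" "cl (f i) \<in> carrier L" by (auto simp: carrier_L)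
    then show ?case using insert by (simp add: add_L)
  qed
qed

text \<open>
  Taking preimages is a bijection between the ideals of the Leavitt path algebra and the ideals of
  the free algebra that contain the relations.
\<close>

definition pull :: "(('a, 'b) lpa_gen list \<Rightarrow>\<^sub>0 'k) set set \<Rightarrow> (('a, 'b) lpa_gen list \<Rightarrow>\<^sub>0 'k) set" where
  "pull I = {f \<in> F. cl f \<in> I}"

lemma 
  assumes "rng_ideal I L"
  shows free_ideal_pull: "free_ideal X (pull I)" and N_subset_pull: "N \<subseteq> pull I"
    and cl_image_pull: "cl ` pull I = I"
proof -
  interpret abelian_group L by (rule abelian_group_L)
  interpret I: additive_subgroup I L using assms by (simp add: rng_ideal_def)
  show "free_ideal X (pull I)"
    unfolding free_ideal_def
  proof (intro conjI ballI)
    show "pull I \<subseteq> F" by (auto simp: pull_def)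
    show "0 \<in> pull I" using I.zero_closed by (simp add: pull_def zero_L)
    fix f assume f: "f \<in> pull I"
    show "f - g \<in> pull I" if "g \<in> pull I" for g
    proof -
      have "cl f \<oplus>\<^bsub>L\<^esub> (\<ominus>\<^bsub>L\<^esub> (cl g)) \<in> I"
        using f that by (intro I.a_closed I.a_inv_closed) (auto simp: pull_def)
      then show ?thesis using f that by (simp add: pull_def a_inv_L add_L)
    qed
    fix g assume g: "g \<in> F"
    then have "cl g \<in> carrier L" by (simp add: carrier_L)
    then have "cl g \<otimes>\<^bsub>L\<^esub> cl f \<in> I" "cl f \<otimes>\<^bsub>L\<^esub> cl g \<in> I"
      using f assms by (auto simp: rng_ideal_def pull_def)
    then show "g * f \<in> pull I" "f * g \<in> pull I" using f g by (simp_all add: pull_def mult_L)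
  qed
  have "cl f = cl 0" if "f \<in> N" for f using that by (simp add: cl_eq_iff)
  then show "N \<subseteq> pull I"
    using I.zero_closed free_ideal_carrier[OF N_free_ideal] by (auto simp: pull_def zero_L)
  show "cl ` pull I = I" using I.a_subset by (auto simp: pull_def carrier_L)
qed

lemma pull_cl_image:
  assumes "free_ideal X S" "N \<subseteq> S"
  shows "pull (cl ` S) = S"
proof -
  have "f \<in> S" if "cl f = cl g" "g \<in> S" for f g
    using that assms(2) by (auto simp: cl_eq_iff intro: free_ideal_transfer[OF assms(1)])
  then show ?thesis using free_ideal_carrier[OF assms(1)] by (auto simp: pull_def)
qed

lemma rng_ideal_cl_image:
  assumes S: "free_ideal X S"
  shows "rng_ideal (cl ` S) L"
proof -
  interpret abelian_group L by (rule abelian_group_L)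
  have "inv\<^bsub>add_monoid L\<^esub> (cl f) \<in> cl ` S" if "f \<in> S" for f
  proof -
    have "inv\<^bsub>add_monoid L\<^esub> (cl f) = cl (- f)"
      using a_inv_L[of f] free_ideal_carrier[OF S that] by (simp add: a_inv_def)
    then show ?thesis using free_ideal_uminus[OF S that] by simp
  qed
  moreover have "cl ` S \<subseteq> carrier L" using free_ideal_carrier[OF S] by (auto simp: carrier_L)
  ultimately have "additive_subgroup (cl ` S) L"
    using free_ideal_zero[OF S] free_ideal_add[OF S]
    by (intro additive_subgroup.intro subgroup.intro) (auto simp: add_L zero_L)
  then show ?thesis
    using free_ideal_carrier[OF S] free_ideal_lmult[OF S] free_ideal_rmult[OF S]
    by (auto simp: rng_ideal_def carrier_L mult_L)
qed

end

section \<open>Reduced words\<close>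

text \<open>
  Most computations concern single words, which either vanish modulo the relations or are congruent
  to a word of a simpler kind.
\<close>

abbreviation weq :: "('g list \<Rightarrow>\<^sub>0 'k::field) set \<Rightarrow> 'g list \<Rightarrow> 'g list \<Rightarrow> bool" where
  "weq S u v \<equiv> word u - word v \<in> S"

abbreviation wnull :: "('g list \<Rightarrow>\<^sub>0 'k::field) set \<Rightarrow> 'g list \<Rightarrow> bool" where
  "wnull S u \<equiv> word u \<in> S"

context leavitt
begin

lemma weq_context:
  assumes "weq N a b" "set u \<subseteq> X" "set v \<subseteq> X"
  shows "weq N (u @ a @ v) (u @ b @ v)"
proof -
  have "word u * (word a - word b) * word v \<in> N"
    using assms by (intro free_ideal_word_lmult[OF N_free_ideal] free_ideal_word_rmult[OF N_free_ideal])
  then show ?thesis by (simp add: algebra_simps)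
qed

lemma wnull_context:
  assumes "wnull N a" "set u \<subseteq> X" "set v \<subseteq> X"
  shows "wnull N (u @ a @ v)"
proof -
  have "word u * word a * word v \<in> N"
    using assms by (intro free_ideal_word_lmult[OF N_free_ideal] free_ideal_word_rmult[OF N_free_ideal])
  then show ?thesis by simp
qed

lemma weq_refl [simp]: "weq N u u" by (simp add: N_zero)

lemma weq_sym: "weq N u v \<Longrightarrow> weq N v u" by (rule N_sym)

lemma weq_trans [trans]: "weq N u v \<Longrightarrow> weq N v w \<Longrightarrow> weq N u w" by (rule N_trans)

lemma weq_wnull: "weq N u v \<Longrightarrow> wnull N v \<Longrightarrow> wnull N u" by (rule free_ideal_transfer[OF N_free_ideal])

lemma weq_Cons: "weq N a b \<Longrightarrow> g \<in> X \<Longrightarrow> weq N (g # a) (g # b)"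
  using weq_context[of a b "[g]" "[]"] by simp

lemma wnull_Cons: "wnull N a \<Longrightarrow> g \<in> X \<Longrightarrow> wnull N (g # a)"
  using wnull_context[of a "[g]" "[]"] by simp

lemma weq_VV: "v \<in> verts E \<Longrightarrow> weq N [Vertex v, Vertex v] [Vertex v]"
  using lpa_relations.vertices[of v E v] relations_in_N by auto

lemma wnull_VV: "v \<in> verts E \<Longrightarrow> w \<in> verts E \<Longrightarrow> v \<noteq> w \<Longrightarrow> wnull N [Vertex v, Vertex w]"
  using lpa_relations.vertices[of v E w] relations_in_N by auto

lemma weq_VE: "e \<in> arcs E \<Longrightarrow> weq N [Vertex (tail E e), Edge e] [Edge e]"
  using lpa_relations.source_edge[of e E] relations_in_N by auto

lemma weq_EV: "e \<in> arcs E \<Longrightarrow> weq N [Edge e, Vertex (head E e)] [Edge e]"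
  using lpa_relations.edge_range[of e E] relations_in_N by auto

lemma weq_VG: "e \<in> arcs E \<Longrightarrow> weq N [Vertex (head E e), Ghost e] [Ghost e]"
  using lpa_relations.range_ghost[of e E] relations_in_N by auto

lemma weq_GV: "e \<in> arcs E \<Longrightarrow> weq N [Ghost e, Vertex (tail E e)] [Ghost e]"
  using lpa_relations.ghost_source[of e E] relations_in_N by auto

lemma weq_GE: "e \<in> arcs E \<Longrightarrow> weq N [Ghost e, Edge e] [Vertex (head E e)]"
  using lpa_relations.CK1[of e E e] relations_in_N by auto

lemma wnull_GE: "e \<in> arcs E \<Longrightarrow> f \<in> arcs E \<Longrightarrow> e \<noteq> f \<Longrightarrow> wnull N [Ghost e, Edge f]"
  using lpa_relations.CK1[of e E f] relations_in_N by auto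

lemma wnull_VE: "e \<in> arcs E \<Longrightarrow> v \<in> verts E \<Longrightarrow> v \<noteq> tail E e \<Longrightarrow> wnull N [Vertex v, Edge e]"
  using weq_wnull[OF weq_Cons[OF weq_sym[OF weq_VE[of e]], of "Vertex v"]]
    wnull_context[OF wnull_VV[of v "tail E e"], of "[]" "[Edge e]"] by simp

lemma wnull_GV: "e \<in> arcs E \<Longrightarrow> v \<in> verts E \<Longrightarrow> v \<noteq> tail E e \<Longrightarrow> wnull N [Ghost e, Vertex v]"
  using weq_wnull[OF weq_context[OF weq_sym[OF weq_GV[of e]], of "[]" "[Vertex v]"]]
    wnull_context[OF wnull_VV[of "tail E e" v], of "[Ghost e]" "[]"] by simp

definition ends_at :: "'a \<Rightarrow> 'b list \<Rightarrow> bool" where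
  "ends_at x p \<longleftrightarrow> (\<exists>s. awalk s p x)"

lemma ends_at_Nil [simp]: "ends_at x [] \<longleftrightarrow> x \<in> verts E"
  by (simp add: ends_at_def awalk_Nil_iff)

lemma ends_at_Cons: "ends_at x (e # p) \<longleftrightarrow> e \<in> arcs E \<and> awalk (head E e) p x"
  by (simp add: ends_at_def awalk_Cons_iff)

lemma ends_atD: "ends_at x p \<Longrightarrow> x \<in> verts E \<and> set p \<subseteq> arcs E"
  by (auto simp: ends_at_def)

text \<open>
  The monomial \<open>p x q\<^sup>*\<close>. Writing down the common range \<open>x\<close> of \<open>p\<close> and \<open>q\<close> makes it
  unnecessary to treat paths of length 0 separately.
\<close>

definition red_word :: "'b list \<Rightarrow> 'a \<Rightarrow> 'b list \<Rightarrow> ('a, 'b) lpa_gen list" where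
  "red_word p x q = map Edge p @ [Vertex x] @ map Ghost (rev q)"

lemma red_word_nonempty [simp]: "red_word p x q \<noteq> []"
  and set_red_word: "ends_at x p \<Longrightarrow> ends_at x q \<Longrightarrow> set (red_word p x q) \<subseteq> X"
  and word_deg_red_word [simp]: "word_deg (red_word p x q) = int (length p) - int (length q)"
  using ends_atD[of x p] ends_atD[of x q] by (auto simp: red_word_def subset_eq)

lemma red_word_Cons: "red_word (e # p) x q = Edge e # red_word p x q"
  by (simp add: red_word_def)

lemma vertex_times_red_word:
  assumes "awalk s p x" "ends_at x q"
  shows "weq N (Vertex s # red_word p x q) (red_word p x q)"
proof (cases p)
  case Nil
  then show ?thesis
    using assms weq_context[OF weq_VV[of x], of "[]" "map Ghost (rev q)"] ends_atD[of x q]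
    by (auto simp: red_word_def awalk_Nil_iff)
next
  case (Cons e p')
  then have "e \<in> arcs E" "s = tail E e" "awalk (head E e) p' x" using assms by (auto simp: awalk_Cons_iff)
  then show ?thesis
    using assms weq_context[OF weq_VE[of e], of "[]" "red_word p' x q"] set_red_word[of x p' q]
    by (auto simp: red_word_Cons Cons ends_at_def)
qed

lemma wnull_vertex_times_red_word:
  assumes "awalk s p x" "ends_at x q" "u \<in> verts E" "u \<noteq> s"
  shows "wnull N (Vertex u # red_word p x q)"
proof -
  have "s \<in> verts E" "set (red_word p x q) \<subseteq> X" using assms set_red_word[of x p q] by (auto simp: ends_at_def)
  then have "wnull N (Vertex u # Vertex s # red_word p x q)"
    using wnull_context[OF wnull_VV[of u s], of "[]" "red_word p x q"] assms by simp
  moreover have "weq N (Vertex u # red_word p x q) (Vertex u # Vertex s # red_word p x q)"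
    using weq_sym[OF vertex_times_red_word[OF assms(1,2)]] assms(3) by (intro weq_Cons) auto
  ultimately show ?thesis using weq_wnull by blast
qed

text \<open>
  The generator is absorbed, prepended to \<open>p\<close>, cancelled against the first edge of \<open>p\<close>, or, for
  a ghost edge and empty \<open>p\<close>, appended to \<open>q\<close>; in all other cases the product vanishes.
\<close>

lemma gen_times_red_word:
  assumes "g \<in> X" "ends_at x p" "ends_at x q"
  shows "wnull N (g # red_word p x q) \<or>
    (\<exists>p' x' q'. ends_at x' p' \<and> ends_at x' q' \<and> weq N (g # red_word p x q) (red_word p' x' q') \<and>
       word_deg (red_word p' x' q') = gen_deg g + word_deg (red_word p x q))"
proof -
  obtain s where s: "awalk s p x" using assms by (auto simp: ends_at_def)
  obtain t where t: "awalk t q x" using assms by (auto simp: ends_at_def)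
  have xv: "x \<in> verts E" and pq: "set p \<subseteq> arcs E" "set q \<subseteq> arcs E" using ends_atD assms by blast+
  note sm = set_red_word[OF assms(2,3)]
  show ?thesis
  proof (cases g)
    case (Vertex u)
    then have "u \<in> verts E" using assms by simp
    show ?thesis
    proof (cases "u = s")
      case True
      then show ?thesis using vertex_times_red_word[OF s assms(3)] assms Vertex by (intro disjI2 exI[of _ p] exI[of _ x] exI[of _ q]) auto
    next
      case False
      then show ?thesis using wnull_vertex_times_red_word[OF s assms(3) \<open>u \<in> verts E\<close>] Vertex by simp
    qed
  next
    case (Edge e)
    then have e: "e \<in> arcs E" using assms by simp
    show ?thesis
    proof (cases "head E e = s")
      case True
      then have "ends_at x (e # p)" using e s by (simp add: ends_at_Cons)
      then show ?thesis
        using Edge assms by (intro disjI2 exI[of _ "e # p"] exI[of _ x] exI[of _ q]) (auto simp: red_word_Cons N_zero)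
    next
      case False
      have "weq N (Edge e # red_word p x q) (Edge e # Vertex (head E e) # red_word p x q)"
        using weq_sym[OF weq_context[OF weq_EV[OF e], of "[]" "red_word p x q"]] sm by simp
      moreover have "wnull N (Edge e # Vertex (head E e) # red_word p x q)"
        using wnull_Cons[OF wnull_vertex_times_red_word[OF s assms(3), of "head E e"], of "Edge e"] False e by simp
      ultimately show ?thesis using weq_wnull Edge by blast
    qed
  next
    case (Ghost e)
    then have e: "e \<in> arcs E" using assms by simp
    show ?thesis
    proof (cases p)
      case Nil
      then have x: "s = x" using s by (simp add: awalk_Nil_iff)
      show ?thesis
      proof (cases "x = tail E e")
        case True
        have "weq N (Ghost e # red_word p x q) (Ghost e # map Ghost (rev q))"
          using weq_context[OF weq_GV[OF e], of "[]" "map Ghost (rev q)"] pq True by (simp add: red_word_def Nil)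
        also have "weq N (Ghost e # map Ghost (rev q)) (red_word [] (head E e) (q @ [e]))"
          using weq_sym[OF weq_context[OF weq_VG[OF e], of "[]" "map Ghost (rev q)"]] pq by (simp add: red_word_def)
        finally have 1: "weq N (Ghost e # red_word p x q) (red_word [] (head E e) (q @ [e]))" .
        have "awalk t (q @ [e]) (head E e)"
          using t True e awalk_appendI[of t q x "[e]" "head E e"] by (simp add: awalk_Cons_iff awalk_Nil_iff)
        then have "ends_at (head E e) (q @ [e])" by (auto simp: ends_at_def)
        then show ?thesis using 1 Ghost e Nil
          by (intro disjI2 exI[of _ "[]"] exI[of _ "head E e"] exI[of _ "q @ [e]"]) auto
      next
        case False
        then have "wnull N (Ghost e # red_word p x q)"
          using wnull_context[OF wnull_GV[OF e xv], of "[]" "map Ghost (rev q)"] pq by (simp add: red_word_def Nil)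
        then show ?thesis using Ghost by simp
      qed
    next
      case (Cons f p')
      have f: "f \<in> arcs E" "awalk (head E f) p' x" using s by (auto simp: Cons awalk_Cons_iff)
      then have p': "ends_at x p'" by (auto simp: ends_at_def)
      note sm' = set_red_word[OF p' assms(3)]
      show ?thesis
      proof (cases "e = f")
        case True
        have "weq N (Ghost e # red_word p x q) (Vertex (head E e) # red_word p' x q)"
          using weq_context[OF weq_GE[OF e], of "[]" "red_word p' x q"] sm' by (simp add: Cons red_word_Cons True)
        also have "weq N (Vertex (head E e) # red_word p' x q) (red_word p' x q)"
          using f by (intro vertex_times_red_word assms) (simp add: True)
        finally show ?thesis
          using p' assms Ghost by (intro disjI2 exI[of _ p'] exI[of _ x] exI[of _ q]) (auto simp: Cons)
      next
        case False
        then have "wnull N (Ghost e # red_word p x q)"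
          using wnull_context[OF wnull_GE[OF e f(1)], of "[]" "red_word p' x q"] sm' by (simp add: Cons red_word_Cons)
        then show ?thesis using Ghost by simp
      qed
    qed
  qed
qed

lemma word_normal_form:
  assumes "w \<noteq> []" "set w \<subseteq> X"
  shows "wnull N w \<or> (\<exists>p x q. ends_at x p \<and> ends_at x q \<and> weq N w (red_word p x q) \<and>
           int (length p) - int (length q) = word_deg w)"
  using assms
proof (induction w rule: list_nonempty_induct)
  case (single g)
  show ?case
  proof (cases g)
    case (Vertex v)
    then show ?thesis using single
      by (intro disjI2 exI[of _ "[]"] exI[of _ v] exI[of _ "[]"]) (auto simp: red_word_def N_zero)
  next
    case (Edge e)
    then have "e \<in> arcs E" using single by simp
    then show ?thesis using Edge weq_sym[OF weq_EV[of e]]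
      by (intro disjI2 exI[of _ "[e]"] exI[of _ "head E e"] exI[of _ "[]"])
        (auto simp: red_word_def ends_at_Cons awalk_Nil_iff)
  next
    case (Ghost e)
    then have "e \<in> arcs E" using single by simp
    then show ?thesis using Ghost weq_sym[OF weq_VG[of e]]
      by (intro disjI2 exI[of _ "[]"] exI[of _ "head E e"] exI[of _ "[e]"])
        (auto simp: red_word_def ends_at_Cons awalk_Nil_iff)
  qed
next
  case (cons g w)
  then have g: "g \<in> X" "set w \<subseteq> X" by auto
  from cons.IH[OF g(2)] show ?case
  proof (elim disjE exE conjE)
    assume "wnull N w"
    then show ?thesis using wnull_Cons g by blast
  next
    fix p x q assume 1: "ends_at x p" "ends_at x q" "weq N w (red_word p x q)" "int (length p) - int (length q) = word_deg w"
    have 2: "weq N (g # w) (g # red_word p x q)" using 1 g by (intro weq_Cons)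
    show ?thesis using gen_times_red_word[OF g(1) 1(1,2)]
    proof (elim disjE exE conjE)
      assume "wnull N (g # red_word p x q)"
      then show ?thesis using 2 weq_wnull by blast
    next
      fix p' x' q' assume "ends_at x' p'" "ends_at x' q'" "weq N (g # red_word p x q) (red_word p' x' q')"
        "word_deg (red_word p' x' q') = gen_deg g + word_deg (red_word p x q)"
      then show ?thesis using weq_trans[OF 2] 1(4)
        by (intro disjI2 exI[of _ p'] exI[of _ x'] exI[of _ q']) auto
    qed
  qed
qed

lemma awalk_weq_range:
  assumes "awalk s p x" "p \<noteq> []"
  shows "weq N (map Edge p @ [Vertex x]) (map Edge p)"
proof -
  obtain p' e where p: "p = p' @ [e]" using assms(2) by (metis rev_exhaust)
  then have "x = head E e" "e \<in> arcs E" "set p' \<subseteq> arcs E"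
    using assms(1) by (auto simp: awalk_append_iff awalk_Cons_iff awalk_Nil_iff)
  then show ?thesis using weq_context[OF weq_EV[of e], of "map Edge p'" "[]"] p by simp
qed

lemma path_ghost_word:
  assumes "awalk s p x" "awalk t q x"
  shows "weq N (red_word p x q) (path_word (s, p) @ ghost_word (t, q))"
proof -
  have q: "set q \<subseteq> arcs E" "x \<in> verts E" using assms by auto
  show ?thesis
  proof (cases "p = []")
    case True
    then show ?thesis using assms q weq_sym[OF weq_VV[of x]] by (auto simp: red_word_def awalk_Nil_iff N_zero)
  next
    case False
    have "weq N (map Edge p @ [Vertex x] @ map Ghost (rev q)) (map Edge p @ map Ghost (rev q))"
      using weq_context[OF awalk_weq_range[OF assms(1) False], of "[]" "map Ghost (rev q)"] q by simp
    then show ?thesis using False assms by (auto simp: red_word_def awalk_Nil_iff N_zero)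
  qed
qed

section \<open>Components and graded ideals\<close>

definition homogeneous :: "int \<Rightarrow> (('a, 'b) lpa_gen list \<Rightarrow>\<^sub>0 'k) set" where
  "homogeneous n = {f \<in> F. hpart n f = f}"

lemma alg_subspace_cl_image:
  assumes "S \<subseteq> F" "0 \<in> S" "\<And>f g. f \<in> S \<Longrightarrow> g \<in> S \<Longrightarrow> f - g \<in> S"
    "\<And>f k. f \<in> S \<Longrightarrow> Poly_Mapping.single [] k * f \<in> S"
  shows "alg_subspace (cl ` S) L"
proof -
  interpret abelian_group L by (rule abelian_group_L)
  have m: "- f \<in> S" if "f \<in> S" for f using assms(3)[OF assms(2) that] by simp
  have a: "f + g \<in> S" if "f \<in> S" "g \<in> S" for f g using assms(3)[OF that(1) m[OF that(2)]] by simp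
  have "inv\<^bsub>add_monoid L\<^esub> (cl f) \<in> cl ` S" if "f \<in> S" for f
  proof -
    have "inv\<^bsub>add_monoid L\<^esub> (cl f) = cl (- f)"
      using a_inv_L[of f] assms(1) that by (auto simp add: a_inv_def)
    then show ?thesis using m that by simp
  qed
  moreover have "cl ` S \<subseteq> carrier L" using assms(1) by (auto simp: carrier_L)
  ultimately show ?thesis
    using assms(2,4) a unfolding alg_subspace_def
    by (intro conjI additive_subgroup.intro subgroup.intro) (auto simp: add_L zero_L smult_L)
qed

lemma word_deg_path_word [simp]: "word_deg (path_word \<mu>) = int (length (snd \<mu>))"
  and word_deg_ghost_word [simp]: "word_deg (ghost_word \<mu>) = - int (length (snd \<mu>))"
  by (cases \<mu>; simp)+

text \<open>
  Words of degree \<open>n\<close> reduce to \<open>p x q\<^sup>*\<close> with \<open>|p| - |q| = n\<close>, so the span of these monomials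
  is the image of the component of degree \<open>n\<close> of the free algebra.
\<close>

lemma lpa_component_eq: "lpa_component E n = cl ` homogeneous n"
proof -
  let ?G = "{lpa_word E (path_word \<mu>) \<otimes>\<^bsub>L\<^esub> lpa_word E (ghost_word \<nu>) | \<mu> \<nu>.
        \<mu> \<in> paths E \<and> \<nu> \<in> paths E \<and> int (length (snd \<mu>)) - int (length (snd \<nu>)) = n}"
  have pw: "path_word \<mu> \<noteq> [] \<and> set (path_word \<mu>) \<subseteq> X \<and> ghost_word \<mu> \<noteq> [] \<and> set (ghost_word \<mu>) \<subseteq> X"
    if "\<mu> \<in> paths E" for \<mu>
    using that by (cases \<mu>) (auto simp: paths_def subset_eq)
  have gen: "lpa_word E (path_word \<mu>) \<otimes>\<^bsub>L\<^esub> lpa_word E (ghost_word \<nu>) = cl (word (path_word \<mu> @ ghost_word \<nu>))"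
    if "\<mu> \<in> paths E" "\<nu> \<in> paths E" for \<mu> \<nu>
    using pw[OF that(1)] pw[OF that(2)] unfolding lpa_word_def by (subst mult_L) auto
  show ?thesis
  proof (rule equalityI)
    show "lpa_component E n \<subseteq> cl ` homogeneous n"
      unfolding lpa_component_def alg_span_def
    proof (rule hull_minimal)
      show "?G \<subseteq> cl ` homogeneous n"
      proof (clarify)
        fix \<mu> \<nu> assume \<mu>: "\<mu> \<in> paths E" and \<nu>: "\<nu> \<in> paths E" and n: "n = int (length (snd \<mu>)) - int (length (snd \<nu>))"
        have "word (path_word \<mu> @ ghost_word \<nu>) \<in> homogeneous n"
          using pw[OF \<mu>] pw[OF \<nu>] n by (simp add: homogeneous_def)
        then show "lpa_word E (path_word \<mu>) \<otimes>\<^bsub>L\<^esub> lpa_word E (ghost_word \<nu>) \<in>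
            cl ` homogeneous (int (length (snd \<mu>)) - int (length (snd \<nu>)))"
          using gen[OF \<mu> \<nu>] n by blast
      qed
      show "alg_subspace (cl ` homogeneous n) L"
        by (rule alg_subspace_cl_image) (auto simp: homogeneous_def hpart_diff hpart_single_mult)
    qed
    show "cl ` homogeneous n \<subseteq> lpa_component E n"
      unfolding lpa_component_def alg_span_def hull_def
    proof (clarify)
      fix f S assume f: "f \<in> homogeneous n" and S: "alg_subspace S L" and G: "?G \<subseteq> S"
      interpret S: additive_subgroup S L using S by (simp add: alg_subspace_def)
      have zero: "cl 0 \<in> S" using S.zero_closed by (simp add: zero_L)
      have keys: "w \<noteq> [] \<and> set w \<subseteq> X \<and> word_deg w = n" if "w \<in> Poly_Mapping.keys f" for w
      proof -
        have "Poly_Mapping.keys f = Poly_Mapping.keys (hpart n f)" using f by (simp add: homogeneous_def)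
        then show ?thesis using that f by (auto simp: keys_hpart homogeneous_def carrier_free_alg)
      qed
      show "cl f \<in> S"
      proof (rule poly_mapping_span_induct[of _ f])
        show "cl 0 \<in> S" by (rule zero)
        show "cl (g + h) \<in> S" if "cl g \<in> S" "cl h \<in> S" for g h
          using S.a_closed[OF that] by (simp add: add_L)
        fix w c assume "w \<in> Poly_Mapping.keys f"
        from keys[OF this] have w: "w \<noteq> []" "set w \<subseteq> X" "word_deg w = n" by auto
        have "cl (word w) \<in> S"
          using word_normal_form[OF w(1,2)]
        proof (elim disjE exE conjE)
          assume "wnull N w"
          then have "cl (word w) = cl 0" by (simp add: cl_eq_iff)
          then show ?thesis using zero by simp
        next
          fix p x q assume 1: "ends_at x p" "ends_at x q" "weq N w (red_word p x q)" "int (length p) - int (length q) = word_deg w"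
          then obtain s t where st: "awalk s p x" "awalk t q x" by (auto simp: ends_at_def)
          then have "(s, p) \<in> paths E" "(t, q) \<in> paths E" by (auto simp: paths_def)
          moreover from this have "lpa_word E (path_word (s, p)) \<otimes>\<^bsub>L\<^esub> lpa_word E (ghost_word (t, q)) \<in> ?G"
            using 1(4) w(3) by (intro CollectI exI[of _ "(s, p)"] exI[of _ "(t, q)"]) simp
          ultimately have "cl (word (path_word (s, p) @ ghost_word (t, q))) \<in> S"
            using G gen[of "(s, p)" "(t, q)"] by (metis (no_types, lifting) subsetD)
          moreover have "cl (word w) = cl (word (path_word (s, p) @ ghost_word (t, q)))"
            unfolding cl_eq_iff using weq_trans[OF 1(3) path_ghost_word[OF st]] .
          ultimately show ?thesis by simp
        qed
        then have "c \<odot>\<^bsub>L\<^esub> cl (word w) \<in> S" using S by (simp add: alg_subspace_def)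
        then show "cl (Poly_Mapping.single w c) \<in> S" by (simp add: smult_L)
      qed
    qed
  qed
qed

lemma lpa_component_hpart: "f \<in> F \<Longrightarrow> cl (hpart n f) \<in> lpa_component E n"
  by (auto simp: lpa_component_eq homogeneous_def)

text \<open>
  Homogeneous representatives of the \<open>c n\<close> add up to \<open>f\<close> modulo relations; as the ideal of
  relations is homogeneous, one may compare the parts of degree \<open>n\<close>.
\<close>

lemma component_decomposition_unique:
  assumes c: "\<And>n. c n \<in> lpa_component E n" and fin: "finite {n. c n \<noteq> \<zero>\<^bsub>L\<^esub>}"
    and f: "cl f = finsum L c {n. c n \<noteq> \<zero>\<^bsub>L\<^esub>}"
  shows "c n = cl (hpart n f)"
proof -
  let ?D = "{n. c n \<noteq> \<zero>\<^bsub>L\<^esub>}"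
  have "\<forall>n. \<exists>g. g \<in> homogeneous n \<and> c n = cl g" using c by (auto simp: lpa_component_eq)
  then obtain g where g: "\<And>n. g n \<in> homogeneous n" "\<And>n. c n = cl (g n)" by metis
  then have c_eq: "c = (\<lambda>n. cl (g n))" by auto
  have gF: "g n \<in> F" for n using g(1) by (auto simp: homogeneous_def)
  have "cl f = cl (sum g ?D)"
    using f finsum_L[OF fin, of g] gF by (simp add: c_eq)
  then have "hpart n (f - sum g ?D) \<in> N" by (intro N_hpart) (simp add: cl_eq_iff)
  moreover have "hpart n (g m) = (if m = n then g m else 0)" for m
  proof -
    have "hpart m (g m) = g m" using g(1)[of m] by (simp add: homogeneous_def)
    then show ?thesis by (metis hpart_hpart)
  qed
  ultimately have *: "cl (hpart n f) = cl (if n \<in> ?D then g n else 0)"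
    using fin by (simp add: cl_eq_iff hpart_diff hpart_sum sum.delta)
  show ?thesis
  proof (cases "n \<in> ?D")
    case True
    then show ?thesis using * g(2)[of n] by simp
  next
    case False
    then show ?thesis using * by (simp add: zero_L)
  qed
qed

lemma lpa_graded_iff:
  assumes I: "rng_ideal I L"
  shows "lpa_graded E I \<longleftrightarrow> (\<forall>f\<in>pull I. \<forall>n. hpart n f \<in> pull I)"
proof
  assume gr: "lpa_graded E I"
  show "\<forall>f\<in>pull I. \<forall>n. hpart n f \<in> pull I"
  proof (intro ballI allI)
    fix f n assume f: "f \<in> pull I"
    then have "cl f \<in> I" by (simp add: pull_def)
    from ex1_implies_ex[OF bspec[OF conjunct2[OF gr[unfolded lpa_graded_def direct_sum_of_def]] this]]
    obtain c where c: "(\<forall>n. c n \<in> I \<inter> lpa_component E n) \<and> finite {n. c n \<noteq> \<zero>\<^bsub>L\<^esub>} \<and>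
      cl f = finsum L c {n. c n \<noteq> \<zero>\<^bsub>L\<^esub>}" ..
    have "c n = cl (hpart n f)" using c by (intro component_decomposition_unique) blast+
    moreover have "c n \<in> I" using c by blast
    ultimately have "cl (hpart n f) \<in> I" by simp
    then show "hpart n f \<in> pull I" using f by (simp add: pull_def)
  qed
next
  assume gr: "\<forall>f\<in>pull I. \<forall>n. hpart n f \<in> pull I"
  show "lpa_graded E I"
    unfolding lpa_graded_def direct_sum_of_def
  proof (intro conjI allI ballI)
    fix x assume "x \<in> I"
    then obtain f where f: "f \<in> pull I" "x = cl f" using cl_image_pull[OF I] by blast
    then have fF: "f \<in> F" by (simp add: pull_def)
    define c where "c n = cl (hpart n f)" for n
    let ?D = "{n. c n \<noteq> \<zero>\<^bsub>L\<^esub>}" and ?A = "word_deg ` Poly_Mapping.keys f"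
    have "n \<in> ?A" if "n \<in> ?D" for n using that hpart_eq_0[of n f] by (auto simp: c_def zero_L)
    then have D: "?D \<subseteq> ?A" by blast
    then have finD: "finite ?D" by (rule finite_subset) simp
    have "f - (\<Sum>n\<in>?D. hpart n f) = (\<Sum>n\<in>?A. hpart n f) - (\<Sum>n\<in>?D. hpart n f)"
      by (simp add: sum_hpart)
    also have "\<dots> = (\<Sum>n\<in>?A - ?D. hpart n f)" using D by (simp add: sum_diff)
    also have "\<dots> \<in> N" by (rule N_sum) (auto simp: c_def zero_L cl_eq_iff)
    finally have "cl f = cl (\<Sum>n\<in>?D. hpart n f)" by (simp add: cl_eq_iff)
    then have sum: "cl f = finsum L c ?D"
    proof -
      have "finsum L (\<lambda>n. cl (hpart n f)) ?D = cl (\<Sum>n\<in>?D. hpart n f)"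
        using fF by (intro finsum_L finD) simp
      moreover have "(\<lambda>n. cl (hpart n f)) = c" by (simp add: c_def fun_eq_iff)
      ultimately show ?thesis using \<open>cl f = _\<close> by simp
    qed
    show "\<exists>!c. (\<forall>n. c n \<in> I \<inter> lpa_component E n) \<and> finite {n. c n \<noteq> \<zero>\<^bsub>L\<^esub>} \<and> x = finsum L c {n. c n \<noteq> \<zero>\<^bsub>L\<^esub>}"
    proof (rule ex1I[of _ c])
      show "(\<forall>n. c n \<in> I \<inter> lpa_component E n) \<and> finite ?D \<and> x = finsum L c ?D"
        using gr f sum finD fF by (auto simp: c_def pull_def intro: lpa_component_hpart)
      show "c' = c" if "(\<forall>n. c' n \<in> I \<inter> lpa_component E n) \<and> finite {n. c' n \<noteq> \<zero>\<^bsub>L\<^esub>} \<and> x = finsum L c' {n. c' n \<noteq> \<zero>\<^bsub>L\<^esub>}" for c'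
      proof
        fix n show "c' n = c n"
          unfolding c_def using that f(2) by (intro component_decomposition_unique) blast+
      qed
    qed
  qed auto
qed

section \<open>Right and left multiplication by edges\<close>

lemma N_subset_core: "free_ideal X S \<Longrightarrow> N \<subseteq> S \<Longrightarrow> N \<subseteq> graded_core S"
  using N_hpart by (auto simp: graded_core_def)

lemma N_single: "wnull N w \<Longrightarrow> Poly_Mapping.single w c \<in> N"
  using N_scale[of "word w" c] by simp

lemma N_single_diff: "weq N u w \<Longrightarrow> Poly_Mapping.single u c - Poly_Mapping.single w c \<in> N"
  using N_scale[of "word u - word w" c] by (simp add: right_diff_distrib)

text \<open>
  For the maps \<open>f \<mapsto> f - \<Sum>\<^bsub>e\<in>B\<^esub> f e e\<^sup>*\<close> and \<open>f \<mapsto> f - \<Sum>\<^bsub>e\<in>B\<^esub> e e\<^sup>* f\<close> below. Different words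
  require different edges; demanding the conclusion for all larger \<open>B\<close>, too, makes the property
  additive in \<open>f\<close>.
\<close>

lemma eventually_null:
  fixes D :: "'b set \<Rightarrow> (('a, 'b) lpa_gen list \<Rightarrow>\<^sub>0 'k) \<Rightarrow> ('a, 'b) lpa_gen list \<Rightarrow>\<^sub>0 'k"
  assumes add: "\<And>B f g. D B (f + g) = D B f + D B g"
    and scale: "\<And>B f c. D B (Poly_Mapping.single [] c * f) = Poly_Mapping.single [] c * D B f"
    and words: "\<And>w. w \<in> Poly_Mapping.keys f \<Longrightarrow> \<exists>A. finite A \<and> A \<subseteq> arcs E \<and>
      (\<forall>B. finite B \<longrightarrow> A \<subseteq> B \<longrightarrow> B \<subseteq> arcs E \<longrightarrow> D B (word w) \<in> N)"
  shows "\<exists>A. finite A \<and> A \<subseteq> arcs E \<and> (\<forall>B. finite B \<longrightarrow> A \<subseteq> B \<longrightarrow> B \<subseteq> arcs E \<longrightarrow> D B f \<in> N)"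
proof (rule poly_mapping_span_induct[of _ f])
  have "D B 0 = 0" for B using scale[of B 0 0] by simp
  then show "\<exists>A. finite A \<and> A \<subseteq> arcs E \<and> (\<forall>B. finite B \<longrightarrow> A \<subseteq> B \<longrightarrow> B \<subseteq> arcs E \<longrightarrow> D B 0 \<in> N)"
    using N_zero by (intro exI[of _ "{}"]) auto
next
  fix g h
  assume "\<exists>A. finite A \<and> A \<subseteq> arcs E \<and> (\<forall>B. finite B \<longrightarrow> A \<subseteq> B \<longrightarrow> B \<subseteq> arcs E \<longrightarrow> D B g \<in> N)"
    and "\<exists>A. finite A \<and> A \<subseteq> arcs E \<and> (\<forall>B. finite B \<longrightarrow> A \<subseteq> B \<longrightarrow> B \<subseteq> arcs E \<longrightarrow> D B h \<in> N)"
  then obtain A A' where "finite A" "A \<subseteq> arcs E" "\<And>B. finite B \<Longrightarrow> A \<subseteq> B \<Longrightarrow> B \<subseteq> arcs E \<Longrightarrow> D B g \<in> N"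
    "finite A'" "A' \<subseteq> arcs E" "\<And>B. finite B \<Longrightarrow> A' \<subseteq> B \<Longrightarrow> B \<subseteq> arcs E \<Longrightarrow> D B h \<in> N"
    by blast
  then show "\<exists>A. finite A \<and> A \<subseteq> arcs E \<and> (\<forall>B. finite B \<longrightarrow> A \<subseteq> B \<longrightarrow> B \<subseteq> arcs E \<longrightarrow> D B (g + h) \<in> N)"
    by (intro exI[of _ "A \<union> A'"]) (auto simp: add intro: N_add)
next
  fix w c assume "w \<in> Poly_Mapping.keys f"
  from words[OF this] obtain A where "finite A" "A \<subseteq> arcs E"
    and A: "\<And>B. finite B \<Longrightarrow> A \<subseteq> B \<Longrightarrow> B \<subseteq> arcs E \<Longrightarrow> D B (word w) \<in> N" by blast
  moreover have "D B (Poly_Mapping.single w c) = Poly_Mapping.single [] c * D B (word w)" for B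
    using scale[of B c "word w"] by simp
  ultimately show "\<exists>A. finite A \<and> A \<subseteq> arcs E \<and> (\<forall>B. finite B \<longrightarrow> A \<subseteq> B \<longrightarrow> B \<subseteq> arcs E \<longrightarrow> D B (Poly_Mapping.single w c) \<in> N)"
    by (intro exI[of _ A]) (auto intro: N_scale)
qed

lemma weq_EGE: "e \<in> arcs E \<Longrightarrow> weq N [Edge e, Ghost e, Edge e] [Edge e]"
  using weq_trans[OF weq_Cons[OF weq_GE[of e], of "Edge e"] weq_EV[of e]] by simp

lemma weq_GEG: "e \<in> arcs E \<Longrightarrow> weq N [Ghost e, Edge e, Ghost e] [Ghost e]"
  using weq_trans[OF weq_context[OF weq_GE[of e], of "[]" "[Ghost e]"] _] weq_VG[of e] by simp

lemma sum_delta_N: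
  assumes "finite B" "e \<in> B" "g e - h \<in> N" "\<And>b. b \<in> B \<Longrightarrow> b \<noteq> e \<Longrightarrow> g b \<in> N"
  shows "h - sum g B \<in> N"
proof -
  have "h - sum g B = - (g e - h) - sum g (B - {e})"
    using assms(1,2) by (simp add: sum.remove)
  also have "\<dots> \<in> N"
    using assms(4) by (intro N_diff[OF N_uminus[OF assms(3)]] N_sum) auto
  finally show ?thesis .
qed

text \<open>
  A reduced word of negative degree ends in a ghost edge \<open>e\<^sup>*\<close>, and \<open>e\<^sup>* b b\<^sup>*\<close> is \<open>e\<^sup>*\<close> for \<open>b = e\<close>
  and vanishes for all other edges \<open>b\<close>.
\<close>

lemma negative_degree_factors:
  assumes "f \<in> F" "hpart n f = f" "n < 0"
  shows "\<exists>A. finite A \<and> A \<subseteq> arcs E \<and> f - (\<Sum>e\<in>A. f * word [Edge e, Ghost e]) \<in> N"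
proof -
  let ?D = "\<lambda>B f. f - (\<Sum>e\<in>B. f * word [Edge e, Ghost e])"
  have "\<exists>A. finite A \<and> A \<subseteq> arcs E \<and> (\<forall>B. finite B \<longrightarrow> A \<subseteq> B \<longrightarrow> B \<subseteq> arcs E \<longrightarrow> ?D B f \<in> N)"
  proof (rule eventually_null)
    fix w assume "w \<in> Poly_Mapping.keys f"
    then have w: "w \<noteq> []" "set w \<subseteq> X" "word_deg w < 0"
      using assms keys_hpart[of n f] by (auto simp: carrier_free_alg)
    from word_normal_form[OF w(1,2)]
    show "\<exists>A. finite A \<and> A \<subseteq> arcs E \<and> (\<forall>B. finite B \<longrightarrow> A \<subseteq> B \<longrightarrow> B \<subseteq> arcs E \<longrightarrow> ?D B (word w) \<in> N)"
    proof (elim disjE exE conjE)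
      assume "wnull N w"
      then have "?D B (word w) \<in> N" if "B \<subseteq> arcs E" for B
        using that by (intro N_diff N_sum free_ideal_word_rmult[OF N_free_ideal]) auto
      then show ?thesis by (intro exI[of _ "{}"]) auto
    next
      fix p x q
      assume 1: "ends_at x p" "ends_at x q" "weq N w (red_word p x q)" "int (length p) - int (length q) = word_deg w"
      then obtain e q' where q: "q = e # q'" using w(3) by (cases q) auto
      let ?u = "map Edge p @ [Vertex x] @ map Ghost (rev q')"
      have u: "red_word p x q = ?u @ [Ghost e]" by (simp add: red_word_def q)
      have uX: "set ?u \<subseteq> X" and e: "e \<in> arcs E" using 1(1,2) by (auto dest!: ends_atD simp: q)
      have "?D B (word w) \<in> N" if B: "finite B" "e \<in> B" "B \<subseteq> arcs E" for B
      proof (rule sum_delta_N[OF B(1,2)])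
        have "weq N (w @ [Edge b, Ghost b]) (?u @ [Ghost e] @ [Edge b, Ghost b])" if "b \<in> B" for b
          using weq_context[OF 1(3), of "[]" "[Edge b, Ghost b]"] B(3) that by (auto simp: u)
        note w_u = this
        show "word w * word [Edge e, Ghost e] - word w \<in> N"
        proof -
          have "weq N (w @ [Edge e, Ghost e]) (?u @ [Ghost e, Edge e, Ghost e] @ [])" using w_u[OF B(2)] by simp
          also have "weq N (?u @ [Ghost e, Edge e, Ghost e] @ []) (?u @ [Ghost e] @ [])"
            using uX by (intro weq_context weq_GEG e) auto
          also have "weq N (?u @ [Ghost e] @ []) w" using weq_sym[OF 1(3)] by (simp add: u)
          finally show ?thesis by simp
        qed
        show "word w * word [Edge b, Ghost b] \<in> N" if "b \<in> B" "b \<noteq> e" for b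
        proof -
          have "b \<in> arcs E" using that B by auto
          then have "wnull N (?u @ [Ghost e, Edge b] @ [Ghost b])"
            using that uX by (intro wnull_context wnull_GE e) auto
          then show ?thesis using w_u[OF that(1)] weq_wnull[of "w @ [Edge b, Ghost b]"] by simp
        qed
      qed
      then show ?thesis using e by (intro exI[of _ "{e}"]) auto
    qed
  qed (simp_all add: sum.distrib distrib_right algebra_simps sum_distrib_left)
  then show ?thesis by blast
qed

text \<open>
  Dually, a reduced word of positive degree begins with an edge.
\<close>

lemma positive_degree_factors:
  assumes "f \<in> F" "hpart n f = f" "n > 0"
  shows "\<exists>A. finite A \<and> A \<subseteq> arcs E \<and> f - (\<Sum>e\<in>A. word [Edge e, Ghost e] * f) \<in> N"
proof -
  let ?D = "\<lambda>B f. f - (\<Sum>e\<in>B. word [Edge e, Ghost e] * f)"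
  have "\<exists>A. finite A \<and> A \<subseteq> arcs E \<and> (\<forall>B. finite B \<longrightarrow> A \<subseteq> B \<longrightarrow> B \<subseteq> arcs E \<longrightarrow> ?D B f \<in> N)"
  proof (rule eventually_null)
    show "?D B (Poly_Mapping.single [] c * f) = Poly_Mapping.single [] c * ?D B f" for B c f
    proof -
      have "word [Edge e, Ghost e] * (Poly_Mapping.single [] c * f) =
            Poly_Mapping.single [] c * (word [Edge e, Ghost e] * f)" for e
        by (simp add: mult.assoc[symmetric])
      then show ?thesis by (simp add: right_diff_distrib sum_distrib_left)
    qed
    fix w assume "w \<in> Poly_Mapping.keys f"
    then have w: "w \<noteq> []" "set w \<subseteq> X" "word_deg w > 0"
      using assms keys_hpart[of n f] by (auto simp: carrier_free_alg)
    from word_normal_form[OF w(1,2)]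
    show "\<exists>A. finite A \<and> A \<subseteq> arcs E \<and> (\<forall>B. finite B \<longrightarrow> A \<subseteq> B \<longrightarrow> B \<subseteq> arcs E \<longrightarrow> ?D B (word w) \<in> N)"
    proof (elim disjE exE conjE)
      assume "wnull N w"
      then have "?D B (word w) \<in> N" if "B \<subseteq> arcs E" for B
        using that by (intro N_diff N_sum free_ideal_word_lmult[OF N_free_ideal]) auto
      then show ?thesis by (intro exI[of _ "{}"]) auto
    next
      fix p x q
      assume 1: "ends_at x p" "ends_at x q" "weq N w (red_word p x q)" "int (length p) - int (length q) = word_deg w"
      then obtain e p' where p: "p = e # p'" using w(3) by (cases p) auto
      let ?u = "red_word p' x q"
      have u: "red_word p x q = Edge e # ?u" by (simp add: red_word_def p)
      have e: "e \<in> arcs E" and uX: "set ?u \<subseteq> X"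
        using set_red_word[OF 1(1,2), unfolded u] by simp_all
      have "?D B (word w) \<in> N" if B: "finite B" "e \<in> B" "B \<subseteq> arcs E" for B
      proof (rule sum_delta_N[OF B(1,2)])
        have "weq N ([Edge b, Ghost b] @ w) ([Edge b, Ghost b, Edge e] @ ?u)" if "b \<in> B" for b
          using weq_context[OF 1(3), of "[Edge b, Ghost b]" "[]"] B(3) that by (auto simp: u)
        note w_u = this
        show "word [Edge e, Ghost e] * word w - word w \<in> N"
        proof -
          have "weq N ([Edge e, Ghost e] @ w) ([] @ [Edge e, Ghost e, Edge e] @ ?u)" using w_u[OF B(2)] by simp
          also have "weq N ([] @ [Edge e, Ghost e, Edge e] @ ?u) ([] @ [Edge e] @ ?u)"
            using uX by (intro weq_context weq_EGE e) auto
          also have "weq N ([] @ [Edge e] @ ?u) w" using weq_sym[OF 1(3)] by (simp add: u)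
          finally show ?thesis by simp
        qed
        show "word [Edge b, Ghost b] * word w \<in> N" if "b \<in> B" "b \<noteq> e" for b
        proof -
          have b: "b \<in> arcs E" using that B by auto
          then have "wnull N ([Edge b] @ [Ghost b, Edge e] @ ?u)"
            using that uX by (intro wnull_context wnull_GE e) auto
          then show ?thesis using w_u[OF that(1)] weq_wnull[of "[Edge b, Ghost b] @ w"] by simp
        qed
      qed
      then show ?thesis using e by (intro exI[of _ "{e}"]) auto
    qed
  qed (simp_all add: sum.distrib distrib_left algebra_simps)
  then show ?thesis by blast
qed

lemma core_if_parts:
  assumes S: "free_ideal X S" and x: "x \<in> S" and parts: "\<And>n. n \<noteq> 0 \<Longrightarrow> hpart n x \<in> S"
  shows "x \<in> graded_core S"
proof -
  let ?D = "insert 0 (word_deg ` Poly_Mapping.keys x)"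
  have "x = (\<Sum>n\<in>?D. hpart n x)" by (rule sum_hpart[symmetric]) auto
  also have "\<dots> = hpart 0 x + (\<Sum>n\<in>?D - {0}. hpart n x)" by (subst sum.remove[of _ 0]) auto
  finally have "hpart 0 x = x - (\<Sum>n\<in>?D - {0}. hpart n x)" by (simp add: algebra_simps)
  also have "\<dots> \<in> S" using x parts by (intro free_ideal_diff[OF S] free_ideal_sum[OF S]) auto
  finally show ?thesis using x parts by (auto simp: graded_core_def) metis
qed

lemma negative_part_in_core:
  assumes S: "free_ideal X S" "N \<subseteq> S" and x: "x \<in> S"
    and stuck: "\<And>e. e \<in> arcs E \<Longrightarrow> x * word [Edge e] \<in> graded_core S" and n: "n < 0"
  shows "hpart n x \<in> graded_core S"
proof -
  note J = free_ideal_graded_core[OF S(1)]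
  obtain A where A: "A \<subseteq> arcs E" "hpart n x - (\<Sum>e\<in>A. hpart n x * word [Edge e, Ghost e]) \<in> N"
    using negative_degree_factors[of "hpart n x" n] x free_ideal_carrier[OF S(1)] n by auto
  have "hpart n x * word [Edge e, Ghost e] \<in> graded_core S" if "e \<in> A" for e
  proof -
    have e: "e \<in> arcs E" using that A by auto
    have "hpart (n + 1) (x * word [Edge e]) * word [Ghost e] \<in> graded_core S"
      using e by (intro free_ideal_word_rmult[OF J hpart_graded_core[OF S(1) stuck[OF e]]]) simp
    then show ?thesis by (simp add: hpart_mult_single mult.assoc)
  qed
  then have "(\<Sum>e\<in>A. hpart n x * word [Edge e, Ghost e]) \<in> graded_core S"
    by (rule free_ideal_sum[OF J])
  then show ?thesis using A(2) N_subset_core[OF S] by (auto intro: free_ideal_transfer[OF J])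
qed

text \<open>
  The induction decreases the bound \<open>d\<close> above which all homogeneous parts are known to be in the
  core: passing from \<open>x\<close> to \<open>e\<^sup>* x\<close> lowers degrees by one and preserves the other hypotheses. Since
  negative parts are in the core anyway, the process stops at \<open>d = 0\<close>.
\<close>

lemma stuck_in_core:
  assumes S: "free_ideal X S" "N \<subseteq> S"
  assumes "x \<in> S" "\<And>e. e \<in> arcs E \<Longrightarrow> x * word [Edge e] \<in> graded_core S"
    and "\<And>n. n \<ge> int d \<Longrightarrow> hpart n x \<in> graded_core S"
  shows "x \<in> graded_core S"
  using assms(3-5)
proof (induction d arbitrary: x)
  case (0 x)
  note J = free_ideal_graded_core[OF S(1)]
  have "hpart n x \<in> graded_core S" for n using 0(3)[of n] negative_part_in_core[OF S 0(1,2)] by (cases "n < 0") auto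
  then show ?case using 0(1) by (auto simp: graded_core_def)
next
  case (Suc d x)
  note J = free_ideal_graded_core[OF S(1)]
  have y: "word [Ghost e] * x \<in> graded_core S" if e: "e \<in> arcs E" for e
  proof (rule Suc.IH)
    show "word [Ghost e] * x \<in> S" using Suc.prems(1) e by (intro free_ideal_word_lmult[OF S(1)]) auto
    show "word [Ghost e] * x * word [Edge e'] \<in> graded_core S" if "e' \<in> arcs E" for e'
      using free_ideal_word_lmult[OF J Suc.prems(2)[OF that], of "[Ghost e]"] e by (simp add: mult.assoc)
    show "hpart n (word [Ghost e] * x) \<in> graded_core S" if "n \<ge> int d" for n
      using free_ideal_word_lmult[OF J Suc.prems(3)[of "n + 1"], of "[Ghost e]"] e that
      by (simp add: hpart_single_mult)
  qed
  have pos: "hpart n x \<in> graded_core S" if n: "n > 0" for n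
  proof -
    obtain A where A: "A \<subseteq> arcs E" "hpart n x - (\<Sum>e\<in>A. word [Edge e, Ghost e] * hpart n x) \<in> N"
      using positive_degree_factors[of "hpart n x" n] Suc.prems(1) free_ideal_carrier[OF S(1)] n by auto
    have "word [Edge e, Ghost e] * hpart n x \<in> graded_core S" if "e \<in> A" for e
    proof -
      have e: "e \<in> arcs E" using that A by auto
      have "word [Edge e] * hpart (n - 1) (word [Ghost e] * x) \<in> graded_core S"
        using e by (intro free_ideal_word_lmult[OF J hpart_graded_core[OF S(1) y[OF e]]]) simp
      then show ?thesis by (simp add: hpart_single_mult mult.assoc[symmetric])
    qed
    then have "(\<Sum>e\<in>A. word [Edge e, Ghost e] * hpart n x) \<in> graded_core S"
      by (rule free_ideal_sum[OF J])
    then show ?thesis using A(2) N_subset_core[OF S] by (auto intro: free_ideal_transfer[OF J])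
  qed
  note neg = negative_part_in_core[OF S Suc.prems(1,2)]
  show ?case
  proof (rule core_if_parts[OF S(1) Suc.prems(1)])
    show "hpart n x \<in> S" if "n \<noteq> 0" for n
      using pos[of n] neg[of n] that by (cases "n > 0") (auto simp: graded_core_def)
  qed
qed

lemma not_stuck:
  assumes S: "free_ideal X S" "N \<subseteq> S" and x: "x \<in> S" "x \<notin> graded_core S"
  shows "\<exists>e\<in>arcs E. x * word [Edge e] \<notin> graded_core S"
proof (rule ccontr)
  assume stuck: "\<not> ?thesis"
  define d where "d = nat (Max (insert 0 (word_deg ` Poly_Mapping.keys x)) + 1)"
  have "x \<in> graded_core S"
  proof (rule stuck_in_core[OF S x(1)])
    fix n assume "n \<ge> int d"
    then have "n > Max (insert 0 (word_deg ` Poly_Mapping.keys x))" unfolding d_def by linarith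
    moreover have "m \<le> Max (insert 0 (word_deg ` Poly_Mapping.keys x))" if "m \<in> word_deg ` Poly_Mapping.keys x" for m
      using that by (intro Max_ge) auto
    ultimately have "n \<notin> word_deg ` Poly_Mapping.keys x" by fastforce
    then show "hpart n x \<in> graded_core S"
      by (simp add: hpart_eq_0 free_ideal_zero[OF free_ideal_graded_core[OF S(1)]])
  qed (use stuck in blast)
  then show False using x(2) by simp
qed

lemma not_stuck_path:
  assumes S: "free_ideal X S" "N \<subseteq> S" and x: "x \<in> S" "x \<notin> graded_core S"
  shows "\<exists>p. length p = m \<and> set p \<subseteq> arcs E \<and> x * word (map Edge p) \<in> S \<and>
    x * word (map Edge p) \<notin> graded_core S"
proof (induction m)
  case 0
  then show ?case using x by simp
next
  case (Suc m)
  then obtain p where p: "length p = m" "set p \<subseteq> arcs E" "x * word (map Edge p) \<in> S"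
    "x * word (map Edge p) \<notin> graded_core S" by blast
  from not_stuck[OF S p(3,4)] obtain e where e: "e \<in> arcs E"
    "x * word (map Edge p) * word [Edge e] \<notin> graded_core S" by blast
  moreover have "x * word (map Edge p) * word [Edge e] \<in> S"
    using e(1) by (intro free_ideal_word_rmult[OF S(1) p(3)]) simp
  ultimately show ?case using p(1,2)
    by (intro exI[of _ "p @ [e]"]) (simp add: mult.assoc)
qed

section \<open>Elements without ghost edges\<close>

text \<open>
  Every ghost edge of \<open>w\<close> cancels against an edge of \<open>p\<close> or makes the product vanish. The strict
  inequality leaves at least one edge, so that vertices can be absorbed.
\<close>

lemma word_times_long_path:
  assumes "set w \<subseteq> X" "set p \<subseteq> arcs E" "length w < length p"
  shows "wnull N (w @ map Edge p) \<or>
    (\<exists>r. r \<noteq> [] \<and> set r \<subseteq> arcs E \<and> length p \<le> length r + length w \<and> weq N (w @ map Edge p) (map Edge r))"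
  using assms
proof (induction w)
  case Nil
  then show ?case by (intro disjI2 exI[of _ p]) (auto simp: N_zero)
next
  case (Cons g w)
  then have g: "g \<in> X" "set w \<subseteq> X" "length w < length p" by auto
  from Cons.IH[OF g(2) Cons.prems(2) g(3)] show ?case
  proof (elim disjE exE conjE)
    assume "wnull N (w @ map Edge p)"
    then show ?thesis using wnull_Cons[OF _ g(1)] by auto
  next
    fix r assume r: "r \<noteq> []" "set r \<subseteq> arcs E" "length p \<le> length r + length w" "weq N (w @ map Edge p) (map Edge r)"
    then obtain f r' where f: "r = f # r'" "f \<in> arcs E" "set r' \<subseteq> arcs E" by (cases r) auto
    have 1: "weq N ((g # w) @ map Edge p) (g # Edge f # map Edge r')"
      using weq_Cons[OF r(4) g(1)] by (simp add: f)
    show ?thesis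
    proof (cases g)
      case (Vertex v)
      show ?thesis
      proof (cases "v = tail E f")
        case True
        have "weq N (g # Edge f # map Edge r') (map Edge r)"
          using weq_context[OF weq_VE[OF f(2)], of "[]" "map Edge r'"] f by (simp add: Vertex True)
        then show ?thesis using weq_trans[OF 1] r by (intro disjI2 exI[of _ r]) auto
      next
        case False
        then have "wnull N (g # Edge f # map Edge r')"
          using wnull_context[OF wnull_VE[OF f(2), of v], of "[]" "map Edge r'"] f g by (simp add: Vertex)
        then show ?thesis using weq_wnull[OF 1] by blast
      qed
    next
      case (Edge e)
      then show ?thesis using 1 r g f by (intro disjI2 exI[of _ "e # r"]) auto
    next
      case (Ghost e)
      then have e: "e \<in> arcs E" using g by simp
      show ?thesis
      proof (cases "e = f")
        case False
        then have "wnull N (g # Edge f # map Edge r')"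
          using wnull_context[OF wnull_GE[OF e f(2)], of "[]" "map Edge r'"] f by (simp add: Ghost)
        then show ?thesis using weq_wnull[OF 1] by blast
      next
        case True
        have "r' \<noteq> []" using r(3) f(1) Cons.prems(3) by auto
        then obtain h r'' where h: "r' = h # r''" "h \<in> arcs E" "set r'' \<subseteq> arcs E" using f(3) by (cases r') auto
        have 2: "weq N (g # Edge f # map Edge r') (Vertex (head E e) # map Edge r')"
          using weq_context[OF weq_GE[OF e], of "[]" "map Edge r'"] f by (simp add: Ghost True)
        show ?thesis
        proof (cases "head E e = tail E h")
          case True
          have "weq N (Vertex (head E e) # map Edge r') (map Edge r')"
            using weq_context[OF weq_VE[OF h(2)], of "[]" "map Edge r''"] h by (simp add: True)
          then have "weq N ((g # w) @ map Edge p) (map Edge r')" using weq_trans[OF weq_trans[OF 1 2]] by blast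
          then show ?thesis using f(3) r(3) \<open>r' \<noteq> []\<close> by (intro disjI2 exI[of _ r']) (auto simp: f(1))
        next
          case False
          then have "wnull N (Vertex (head E e) # map Edge r')"
            using wnull_context[OF wnull_VE[OF h(2), of "head E e"], of "[]" "map Edge r''"] h e by simp
          then show ?thesis using weq_wnull[OF weq_trans[OF 1 2]] by blast
        qed
      qed
    qed
  qed
qed

lemma path_or_null:
  assumes "set p \<subseteq> arcs E" "v \<in> verts E"
  shows "ends_at v p \<or> wnull N (map Edge p @ [Vertex v])"
  using assms(1)
proof (induction p)
  case (Cons e p)
  then have e: "e \<in> arcs E" by simp
  from Cons have "ends_at v p \<or> wnull N (map Edge p @ [Vertex v])" by simp
  then show ?case
  proof
    assume "wnull N (map Edge p @ [Vertex v])"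
    then show ?thesis using wnull_Cons[of _ "Edge e"] e by simp
  next
    assume "ends_at v p"
    then obtain s where s: "awalk s p v" by (auto simp: ends_at_def)
    show ?thesis
    proof (cases "head E e = s")
      case True
      then show ?thesis using s e by (simp add: ends_at_Cons)
    next
      case False
      have vX: "set (red_word p v []) \<subseteq> X" using \<open>ends_at v p\<close> assms(2) by (intro set_red_word) auto
      have "wnull N (Vertex (head E e) # red_word p v [])"
        using False e assms(2) by (intro wnull_vertex_times_red_word[OF s]) auto
      then have "wnull N (Edge e # Vertex (head E e) # red_word p v [])"
        by (rule wnull_Cons) (simp add: e)
      moreover have "weq N (Edge e # red_word p v []) (Edge e # Vertex (head E e) # red_word p v [])"
        using weq_sym[OF weq_context[OF weq_EV[OF e], of "[]" "red_word p v []"]] vX by simp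
      ultimately show ?thesis using weq_wnull by (simp add: red_word_def)
    qed
  qed
qed (use assms in simp)

abbreviation pword :: "'a \<Rightarrow> 'b list \<Rightarrow> ('a, 'b) lpa_gen list" where
  "pword v p \<equiv> map Edge p @ [Vertex v]"

lemma pword_red_word: "pword v p = red_word p v []"
  by (simp add: red_word_def)

text \<open>
  The linear combinations of paths that end at \<open>v\<close>. The terminal vertex is part of the words, so
  that \<open>v\<close> itself is included.
\<close>

definition path_combs :: "'a \<Rightarrow> (('a, 'b) lpa_gen list \<Rightarrow>\<^sub>0 'k) set" where
  "path_combs v = {y. \<forall>u\<in>Poly_Mapping.keys y. \<exists>p. u = pword v p \<and> ends_at v p}"

lemma path_combs_add: "y \<in> path_combs v \<Longrightarrow> z \<in> path_combs v \<Longrightarrow> y + z \<in> path_combs v"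
  using keys_add[of y z] unfolding path_combs_def by blast

lemma path_combs_single: "ends_at v p \<Longrightarrow> Poly_Mapping.single (pword v p) c \<in> path_combs v"
  by (auto simp: path_combs_def)

lemma path_combs_F: 
  assumes "y \<in> path_combs v" "v \<in> verts E" shows "y \<in> F"
proof -
  have "u \<noteq> [] \<and> set u \<subseteq> X" if u: "u \<in> Poly_Mapping.keys y" for u
  proof -
    obtain p where "u = pword v p" "ends_at v p" using assms u by (auto simp: path_combs_def)
    then show ?thesis using ends_atD[of v p] by auto
  qed
  then show ?thesis by (simp add: carrier_free_alg)
qed

lemma times_long_path_comb:
  assumes x: "x \<in> F" and p: "set p \<subseteq> arcs E" and v: "v \<in> verts E"
    and len: "\<And>w. w \<in> Poly_Mapping.keys x \<Longrightarrow> length w < length p"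
  shows "\<exists>y\<in>path_combs v. x * word (pword v p) - y \<in> N"
proof (rule poly_mapping_span_induct[of _ x])
  show "\<exists>y\<in>path_combs v. 0 * word (pword v p) - y \<in> N"
    by (intro bexI[of _ 0]) (auto simp: N_zero path_combs_def)
next
  fix f g assume "\<exists>y\<in>path_combs v. f * word (pword v p) - y \<in> N" "\<exists>y\<in>path_combs v. g * word (pword v p) - y \<in> N"
  then obtain y z where "y \<in> path_combs v" "f * word (pword v p) - y \<in> N" "z \<in> path_combs v" "g * word (pword v p) - z \<in> N"
    by blast
  then show "\<exists>y\<in>path_combs v. (f + g) * word (pword v p) - y \<in> N"
    using N_add[of "f * word (pword v p) - y" "g * word (pword v p) - z"]
    by (intro bexI[of _ "y + z"] path_combs_add) (simp_all add: algebra_simps)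
next
  fix w c assume w: "w \<in> Poly_Mapping.keys x"
  then have wX: "set w \<subseteq> X" using x by (auto simp: carrier_free_alg)
  have null: "\<exists>y\<in>path_combs v. Poly_Mapping.single w c * word (pword v p) - y \<in> N"
    if "wnull N (w @ pword v p)"
    using N_single[OF that, of c] by (intro bexI[of _ 0]) (auto simp: path_combs_def)
  from word_times_long_path[OF wX p len[OF w]]
  show "\<exists>y\<in>path_combs v. Poly_Mapping.single w c * word (pword v p) - y \<in> N"
  proof (elim disjE exE conjE)
    assume "wnull N (w @ map Edge p)"
    then have "wnull N (w @ pword v p)" using wnull_context[of "w @ map Edge p" "[]" "[Vertex v]"] v by simp
    then show ?thesis by (rule null)
  next
    fix r assume r: "set r \<subseteq> arcs E" "weq N (w @ map Edge p) (map Edge r)"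
    have wr: "weq N (w @ pword v p) (pword v r)" using weq_context[OF r(2), of "[]" "[Vertex v]"] v by simp
    from path_or_null[OF r(1) v] show ?thesis
    proof
      assume "ends_at v r"
      then show ?thesis using N_single_diff[OF wr, of c]
        by (intro bexI[of _ "Poly_Mapping.single (pword v r) c"] path_combs_single) simp_all
    next
      assume "wnull N (pword v r)"
      then show ?thesis using weq_wnull[OF wr] null by blast
    qed
  qed
qed

lemma exists_path_comb:
  assumes S: "free_ideal X S" "N \<subseteq> S" and x: "x \<in> S" "x \<notin> graded_core S"
  shows "\<exists>v\<in>verts E. \<exists>y\<in>path_combs v. y \<in> S \<and> y \<notin> graded_core S"
proof -
  note J = free_ideal_graded_core[OF S(1)]
  define m where "m = Suc (Max (insert 0 (length ` Poly_Mapping.keys x)))"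
  have len: "length w < m" if "w \<in> Poly_Mapping.keys x" for w
    using that by (auto simp: m_def less_Suc_eq_le intro!: Max_ge)
  from not_stuck_path[OF S x, of m] obtain p where p: "length p = m" "set p \<subseteq> arcs E"
    "x * word (map Edge p) \<in> S" "x * word (map Edge p) \<notin> graded_core S" by blast
  from p(1) have "p \<noteq> []" by (auto simp: m_def)
  then obtain p' e where pe: "p = p' @ [e]" by (metis rev_exhaust)
  then have e: "e \<in> arcs E" using p(2) by simp
  define v where "v = head E e"
  have v: "v \<in> verts E" using e by (simp add: v_def)
  have xF: "x \<in> F" using x(1) free_ideal_carrier[OF S(1)] by blast
  obtain y where y: "y \<in> path_combs v" "x * word (pword v p) - y \<in> N"
    using times_long_path_comb[OF xF p(2) v] len p(1) by auto
  have "weq N (pword v p) (map Edge p)"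
    using weq_context[OF weq_EV[OF e], of "map Edge p'" "[]"] p(2) by (simp add: pe v_def)
  then have "x * (word (pword v p) - word (map Edge p)) \<in> N"
    by (rule free_ideal_lmult[OF N_free_ideal _ xF])
  then have "x * word (map Edge p) - x * word (pword v p) \<in> N"
    using N_sym by (simp add: right_diff_distrib)
  then have d: "x * word (map Edge p) - y \<in> N" using N_trans y(2) by blast
  have "y \<in> S" by (rule free_ideal_transfer'[OF S(1) subsetD[OF S(2) d] p(3)])
  moreover have "y \<notin> graded_core S"
    using free_ideal_transfer[OF J subsetD[OF N_subset_core[OF S] d]] p(4) by (rule contrapos_nn[rotated])
  ultimately show ?thesis using v y(1) by blast
qed

lemma ghost_path:
  assumes "ends_at v p" "set q \<subseteq> arcs E" "length q \<le> length p"
  shows "(\<exists>r. p = q @ r \<and> ends_at v r \<and> weq N (map Ghost (rev q) @ pword v p) (pword v r)) \<or>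
    (\<not> prefix q p \<and> wnull N (map Ghost (rev q) @ pword v p))"
  using assms
proof (induction q arbitrary: p)
  case (Nil p)
  then show ?case by (intro disjI1 exI[of _ p]) (simp add: N_zero)
next
  case (Cons e q p)
  then obtain f p' where p: "p = f # p'" by (cases p) auto
  have f: "f \<in> arcs E" "awalk (head E f) p' v" using Cons.prems(1) by (auto simp: p ends_at_Cons)
  have p': "ends_at v p'" using f(2) by (auto simp: ends_at_def)
  have v: "v \<in> verts E" using ends_atD[OF p'] by simp
  have p'X: "set (pword v p') \<subseteq> X" using ends_atD[OF p'] by auto
  have qX: "set (map Ghost (rev q)) \<subseteq> X" and e: "e \<in> arcs E" using Cons.prems(2) by auto
  show ?case
  proof (cases "e = f")
    case False
    have "wnull N (map Ghost (rev q) @ [Ghost e, Edge f] @ pword v p')"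
      using wnull_GE[OF e f(1) False] qX p'X by (rule wnull_context)
    then show ?thesis using False by (intro disjI2) (simp add: p)
  next
    case True
    have "weq N (map Ghost (rev q) @ [Ghost e, Edge e] @ pword v p') (map Ghost (rev q) @ [Vertex (head E e)] @ pword v p')"
      using weq_GE[OF e] qX p'X by (rule weq_context)
    also have "weq N (map Ghost (rev q) @ [Vertex (head E e)] @ pword v p') (map Ghost (rev q) @ pword v p')"
      using weq_context[OF vertex_times_red_word[OF f(2), of "[]"] qX, of "[]"] v by (simp add: pword_red_word True)
    finally have 1: "weq N (map Ghost (rev (e # q)) @ pword v p) (map Ghost (rev q) @ pword v p')"
      by (simp add: p True)
    have "set q \<subseteq> arcs E" "length q \<le> length p'" using Cons.prems(2,3) by (simp_all add: p)
    from Cons.IH[OF p' this] show ?thesis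
    proof (elim disjE exE conjE)
      fix r assume "p' = q @ r" "ends_at v r" "weq N (map Ghost (rev q) @ pword v p') (pword v r)"
      then show ?thesis using weq_trans[OF 1] by (intro disjI1 exI[of _ r]) (auto simp: p True)
    next
      assume "\<not> prefix q p'" "wnull N (map Ghost (rev q) @ pword v p')"
      then show ?thesis using weq_wnull[OF 1] by (intro disjI2) (auto simp: p)
    qed
  qed
qed

text \<open>
  Computes \<open>v q\<^sup>* p v\<close>: it is what remains of \<open>p\<close> after removal of the prefix \<open>q\<close>, and it
  vanishes if there is no such prefix or if the rest is not a walk from \<open>v\<close> to \<open>v\<close>.
\<close>

lemma corner_path:
  assumes "ends_at v p" "set q \<subseteq> arcs E" "length q \<le> length p"
  shows "(\<exists>r. p = q @ r \<and> awalk v r v \<and> weq N ((Vertex v # map Ghost (rev q)) @ pword v p) (pword v r)) \<or>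
    ((\<nexists>r. p = q @ r \<and> awalk v r v) \<and> wnull N ((Vertex v # map Ghost (rev q)) @ pword v p))"
proof -
  have v: "v \<in> verts E" using ends_atD[OF assms(1)] by simp
  from ghost_path[OF assms] show ?thesis unfolding append_Cons
  proof (elim disjE exE conjE)
    fix r assume r: "p = q @ r" "ends_at v r" "weq N (map Ghost (rev q) @ pword v p) (pword v r)"
    have 1: "weq N (Vertex v # map Ghost (rev q) @ pword v p) (Vertex v # pword v r)"
      using v by (intro weq_Cons[OF r(3)]) simp
    show "(\<exists>r. p = q @ r \<and> awalk v r v \<and> weq N (Vertex v # map Ghost (rev q) @ pword v p) (pword v r)) \<or>
    ((\<nexists>r. p = q @ r \<and> awalk v r v) \<and> wnull N (Vertex v # map Ghost (rev q) @ pword v p))"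
    proof (cases "awalk v r v")
      case True
      have "weq N (Vertex v # pword v r) (pword v r)"
        using vertex_times_red_word[OF True, of "[]"] v by (simp add: pword_red_word)
      then have "weq N (Vertex v # map Ghost (rev q) @ pword v p) (pword v r)" by (rule weq_trans[OF 1])
      then show "(\<exists>r. p = q @ r \<and> awalk v r v \<and> weq N (Vertex v # map Ghost (rev q) @ pword v p) (pword v r)) \<or>
    ((\<nexists>r. p = q @ r \<and> awalk v r v) \<and> wnull N (Vertex v # map Ghost (rev q) @ pword v p))" using r(1) True by blast
    next
      case False
      then obtain s where s: "awalk s r v" "v \<noteq> s" using r(2) by (auto simp: ends_at_def)
      have "wnull N (Vertex v # pword v r)"
        using wnull_vertex_times_red_word[OF s(1) _ v s(2), of "[]"] v by (simp add: pword_red_word)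
      then have "wnull N (Vertex v # map Ghost (rev q) @ pword v p)" by (rule weq_wnull[OF 1])
      then show "(\<exists>r. p = q @ r \<and> awalk v r v \<and> weq N (Vertex v # map Ghost (rev q) @ pword v p) (pword v r)) \<or>
    ((\<nexists>r. p = q @ r \<and> awalk v r v) \<and> wnull N (Vertex v # map Ghost (rev q) @ pword v p))" using r(1) False by blast
    qed
  next
    assume "\<not> prefix q p" "wnull N (map Ghost (rev q) @ pword v p)"
    then show "(\<exists>r. p = q @ r \<and> awalk v r v \<and> weq N (Vertex v # map Ghost (rev q) @ pword v p) (pword v r)) \<or>
    ((\<nexists>r. p = q @ r \<and> awalk v r v) \<and> wnull N (Vertex v # map Ghost (rev q) @ pword v p))" using wnull_Cons[of _ "Vertex v"] v by (intro disjI2 conjI) auto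
  qed
qed

definition closed_sum :: "'a \<Rightarrow> ('k \<times> 'b list) list \<Rightarrow> ('a, 'b) lpa_gen list \<Rightarrow>\<^sub>0 'k" where
  "closed_sum v xs = (\<Sum>(d, p)\<leftarrow>xs. Poly_Mapping.single (pword v p) d)"

lemma closed_sum_simps [simp]:
  "closed_sum v [] = 0"
  "closed_sum v ((d, p) # xs) = Poly_Mapping.single (pword v p) d + closed_sum v xs"
  by (simp_all add: closed_sum_def)

text \<open>
  Multiplication by \<open>v q\<^sup>*\<close> for a shortest path \<open>q\<close> in the support of \<open>y\<close> turns \<open>q\<close> into
  \<open>v\<close> and each other path into a nontrivial closed path at \<open>v\<close> or zero.
\<close>

lemma path_comb_to_closed_sum:
  assumes S: "free_ideal X S" "N \<subseteq> S" and y: "y \<in> path_combs v" "y \<in> S" "y \<noteq> 0" and v: "v \<in> verts E"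
  shows "\<exists>c xs. c \<noteq> 0 \<and> (\<forall>(d, p)\<in>set xs. closed_path_at E v p) \<and>
    Poly_Mapping.single [Vertex v] c + closed_sum v xs \<in> S"
proof -
  let ?K = "Poly_Mapping.keys y"
  have "?K \<noteq> {}" using y(3) by simp
  then obtain u1 where "is_arg_min length (\<lambda>u. u \<in> ?K) u1"
    using ex_is_arg_min_if_finite[of ?K length] by auto
  then have u1: "u1 \<in> ?K" "\<And>u. u \<in> ?K \<Longrightarrow> length u1 \<le> length u"
    by (auto simp: is_arg_min_linorder)
  from u1(1) y(1) obtain q where q: "u1 = pword v q" "ends_at v q" by (auto simp: path_combs_def)
  have qE: "set q \<subseteq> arcs E" using ends_atD[OF q(2)] by simp
  let ?g = "Vertex v # map Ghost (rev q)"
  let ?m = "\<lambda>w. Poly_Mapping.single w (Poly_Mapping.lookup y w)"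
  have rest: "\<exists>xs. (\<forall>(d, p)\<in>set xs. closed_path_at E v p) \<and> word ?g * (\<Sum>w\<in>A. ?m w) - closed_sum v xs \<in> N"
    if "finite A" "A \<subseteq> ?K - {u1}" for A
    using that
  proof (induction rule: finite_induct)
    case empty
    then show ?case by (intro exI[of _ "[]"]) (simp add: N_zero)
  next
    case (insert w A)
    then obtain xs where xs: "\<forall>(d, p)\<in>set xs. closed_path_at E v p"
      "word ?g * (\<Sum>w\<in>A. ?m w) - closed_sum v xs \<in> N" by blast
    from insert.prems y(1) obtain p where p: "w = pword v p" "ends_at v p" by (auto simp: path_combs_def)
    have "p \<noteq> q" using insert.prems p q by auto
    have "length q \<le> length p" using u1(2)[of w] insert.prems by (simp add: p q)
    from corner_path[OF p(2) qE this] show ?case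
    proof (elim disjE exE conjE)
      fix r assume r: "p = q @ r" "awalk v r v" "weq N (?g @ pword v p) (pword v r)"
      have "closed_path_at E v r" using r \<open>p \<noteq> q\<close> by (auto simp: closed_path_at_def)
      moreover have "word ?g * (\<Sum>w\<in>insert w A. ?m w) - closed_sum v ((Poly_Mapping.lookup y w, r) # xs) \<in> N"
        using N_add[OF N_single_diff[OF r(3), of "Poly_Mapping.lookup y w"] xs(2)] insert.hyps
        by (simp add: distrib_left p(1) algebra_simps)
      ultimately show ?thesis using xs(1) by (intro exI[of _ "(Poly_Mapping.lookup y w, r) # xs"]) auto
    next
      assume null: "wnull N (?g @ pword v p)"
      have "word ?g * (\<Sum>w\<in>insert w A. ?m w) - closed_sum v xs \<in> N"
        using N_add[OF N_single[OF null, of "Poly_Mapping.lookup y w"] xs(2)] insert.hyps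
        by (simp add: distrib_left p(1) algebra_simps)
      then show ?thesis using xs(1) by blast
    qed
  qed
  obtain xs where xs: "\<forall>(d, p)\<in>set xs. closed_path_at E v p"
    "word ?g * (\<Sum>w\<in>?K - {u1}. ?m w) - closed_sum v xs \<in> N" using rest[of "?K - {u1}"] by auto
  have 1: "weq N (?g @ pword v q) [Vertex v]"
    using corner_path[OF q(2) qE order_refl] v by (auto simp: awalk_Nil_iff)
  let ?c = "Poly_Mapping.lookup y u1"
  have "y = (\<Sum>w\<in>?K. ?m w)" by (rule poly_mapping_sum_singles)
  also have "\<dots> = ?m u1 + (\<Sum>w\<in>?K - {u1}. ?m w)" using u1(1) by (simp add: sum.remove)
  finally have "word ?g * y = word ?g * (?m u1 + (\<Sum>w\<in>?K - {u1}. ?m w))" by (rule arg_cong)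
  then have "word ?g * y = word ?g * ?m u1 + word ?g * (\<Sum>w\<in>?K - {u1}. ?m w)" unfolding distrib_left .
  then have "word ?g * y - (Poly_Mapping.single [Vertex v] ?c + closed_sum v xs) =
      (Poly_Mapping.single (?g @ pword v q) ?c - Poly_Mapping.single [Vertex v] ?c) +
      (word ?g * (\<Sum>w\<in>?K - {u1}. ?m w) - closed_sum v xs)"
    by (simp add: q(1))
  also have "\<dots> \<in> N" using N_single_diff[OF 1] xs(2) by (rule N_add)
  finally have 2: "word ?g * y - (Poly_Mapping.single [Vertex v] ?c + closed_sum v xs) \<in> S" using S(2) by blast
  have "word ?g * y \<in> S" using v qE by (intro free_ideal_word_lmult[OF S(1) y(2)]) auto
  from free_ideal_transfer'[OF S(1) 2 this] show ?thesis
    using u1(1) xs(1) by (intro exI[of _ ?c] exI[of _ xs]) (auto simp: in_keys_iff)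
qed

section \<open>Condition (K) makes all ideals graded\<close>

lemma closed_path_power:
  assumes "closed_path_at E v p"
  shows "closed_path_at E v (concat (replicate (Suc n) p))"
  using assms by (induction n) (auto simp: closed_path_at_def intro: awalk_appendI)

lemma set_concat_replicate: "set (concat (replicate (Suc n) p)) = set p"
  by (induction n) auto

lemma length_concat_replicate: "length (concat (replicate n p)) = n * length p"
  by (induction n) auto

lemma prefix_power:
  assumes "prefix q (p @ q)"
  shows "prefix q (concat (replicate m p) @ q)"
proof (induction m)
  case (Suc m)
  have "prefix (p @ q) (p @ concat (replicate m p) @ q)" using Suc by simp
  then show ?case using assms by (auto intro: prefix_order.trans)
qed simp

text \<open>
  If every closed path \<open>q\<close> at \<open>v\<close> were a prefix of \<open>p q\<close>, it would be a prefix of a power of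
  \<open>p\<close>. Then \<open>q\<close> uses only edges of \<open>p\<close>; and \<open>p\<close> is a prefix of every power of \<open>q\<close>
  that is long enough, as both are prefixes of the same power of \<open>p\<close>. So \<open>p\<close> and \<open>q\<close> would have the same edges.
\<close>

lemma condition_K_escape:
  assumes K: "condition_K E" and p: "closed_path_at E v p"
  shows "\<exists>q. closed_path_at E v q \<and> \<not> prefix q (p @ q)"
proof (rule ccontr)
  assume "\<nexists>q. closed_path_at E v q \<and> \<not> prefix q (p @ q)"
  then have pre: "prefix q (p @ q)" if "closed_path_at E v q" for q using that by blast
  have "p \<noteq> []" using p by (simp add: closed_path_at_def)
  have pow: "prefix q (concat (replicate m p))" if q: "closed_path_at E v q" and m: "length q \<le> m" for q m
  proof -
    have "length q \<le> length (concat (replicate m p))"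
      using m \<open>p \<noteq> []\<close> unfolding length_concat_replicate by (cases p) auto
    then show ?thesis
      using prefix_power[OF pre[OF q], of m] by (meson prefixI prefix_length_prefix)
  qed
  have "v \<in> set (awalk_verts v p)" using p by (auto simp: closed_path_at_def intro: hd_in_awalk_verts)
  then obtain q where q: "closed_path_at E v q" "set q \<noteq> set p"
    using K p unfolding condition_K_def by blast
  have "set q \<subseteq> set (concat (replicate (Suc (length q)) p))"
    using pow[OF q(1), of "Suc (length q)"] by (intro set_mono_prefix) simp
  then have "set q \<subseteq> set p" by (simp only: set_concat_replicate)
  moreover have "set p \<subseteq> set q"
  proof -
    let ?qq = "concat (replicate (Suc (length p)) q)"
    have "q \<noteq> []" using q by (simp add: closed_path_at_def)
    then have "length p \<le> length ?qq" unfolding length_concat_replicate by (cases q) auto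
    moreover have "prefix ?qq (concat (replicate (Suc (length ?qq)) p))"
      by (rule pow[OF closed_path_power[OF q(1)]]) simp
    moreover have "prefix p (concat (replicate (Suc (length ?qq)) p))" by simp
    ultimately have "prefix p ?qq" by (meson prefix_length_prefix)
    then show ?thesis using set_mono_prefix[of p ?qq] by (simp only: set_concat_replicate)
  qed
  ultimately show False using q(2) by blast
qed

text \<open>
  For a closed path \<open>p\<close> in the sum choose \<open>q\<close> by condition (K) and sandwich the element between
  \<open>v q\<^sup>*\<close> and \<open>q v\<close>. The vertex term survives, \<open>p\<close> disappears, and every other closed path \<open>r\<close>
  either disappears or is replaced by the path \<open>r'\<close> with \<open>r q = q r'\<close>, which has the same length as
  \<open>r\<close> and thus is again nontrivial. As the terms form a list, it does not matter
  whether different \<open>r\<close> can lead to the same \<open>r'\<close>.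
\<close>

lemma vertex_in_if_closed_sum:
  assumes K: "condition_K E" and S: "free_ideal X S" "N \<subseteq> S" and v: "v \<in> verts E" and c: "c \<noteq> 0"
    and xs: "\<forall>(d, p)\<in>set xs. closed_path_at E v p"
    and "Poly_Mapping.single [Vertex v] c + closed_sum v xs \<in> S"
  shows "word [Vertex v] \<in> S"
  using xs assms(7)
proof (induction "length xs" arbitrary: xs rule: less_induct)
  case (less xs)
  show ?case
  proof (cases xs)
    case Nil
    then have "Poly_Mapping.single [Vertex v] (1 / c) * Poly_Mapping.single [Vertex v] c \<in> S"
      using less.prems(2) v by (intro free_ideal_lmult[OF S(1)]) auto
    then have "word [Vertex v, Vertex v] \<in> S" using c by simp
    then show ?thesis using free_ideal_transfer'[OF S(1) subsetD[OF S(2) weq_VV[OF v]]] by blast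
  next
    case (Cons dp xs')
    obtain d p where dp: "dp = (d, p)" by (cases dp)
    have p: "closed_path_at E v p" and xs': "\<forall>(d, p)\<in>set xs'. closed_path_at E v p"
      using less.prems(1) by (auto simp: Cons dp)
    obtain q where q: "closed_path_at E v q" "\<not> prefix q (p @ q)" using condition_K_escape[OF K p] by blast
    have qw: "awalk v q v" using q(1) by (simp add: closed_path_at_def)
    then have qE: "set q \<subseteq> arcs E" by auto
    let ?g = "Vertex v # map Ghost (rev q)"
    let ?T = "\<lambda>f. word ?g * f * word (pword v q)"
    have T_word: "weq N (?g @ pword v r @ pword v q) (?g @ pword v (r @ q))" if "set r \<subseteq> arcs E" for r
      using weq_context[OF vertex_times_red_word[OF qw, of "[]"], of "?g @ map Edge r" "[]"] that qE v
      by (simp add: pword_red_word[symmetric]) 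
    have T: "(\<exists>r'. closed_path_at E v r' \<and> weq N (?g @ pword v r @ pword v q) (pword v r')) \<or>
        wnull N (?g @ pword v r @ pword v q)" if r: "closed_path_at E v r" for r
    proof -
      have rw: "awalk v r v" "r \<noteq> []" using r by (auto simp: closed_path_at_def)
      then have rE: "set r \<subseteq> arcs E" by auto
      have "awalk v (r @ q) v" using rw(1) qw by (rule awalk_appendI)
      then have rq: "ends_at v (r @ q)" by (auto simp: ends_at_def)
      have len: "length q \<le> length (r @ q)" by simp
      from corner_path[OF rq qE len] show ?thesis
      proof (elim disjE exE conjE)
        fix r' assume r': "r @ q = q @ r'" "awalk v r' v" "weq N (?g @ pword v (r @ q)) (pword v r')"
        have "length r' = length r" using arg_cong[OF r'(1), of length] by simp
        then have "r' \<noteq> []" using rw(2) by auto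
        then show ?thesis using weq_trans[OF T_word[OF rE]] r' by (auto simp: closed_path_at_def)
      next
        assume "wnull N (?g @ pword v (r @ q))"
        then show ?thesis using weq_wnull[OF T_word[OF rE]] by blast
      qed
    qed
    have rest: "\<exists>zs. length zs \<le> length ys \<and> (\<forall>(d, p)\<in>set zs. closed_path_at E v p) \<and>
        ?T (closed_sum v ys) - closed_sum v zs \<in> N"
      if "\<forall>(d, p)\<in>set ys. closed_path_at E v p" for ys
      using that
    proof (induction ys)
      case Nil
      show ?case by (intro exI[of _ "[]"]) (simp add: N_zero)
    next
      case (Cons er ys)
      obtain e r where er: "er = (e, r)" by (cases er)
      have r: "closed_path_at E v r" using Cons.prems by (simp add: er)
      obtain zs where zs: "length zs \<le> length ys" "\<forall>(d, p)\<in>set zs. closed_path_at E v p"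
        "?T (closed_sum v ys) - closed_sum v zs \<in> N" using Cons by auto
      have step: "?T (closed_sum v (er # ys)) =
          Poly_Mapping.single (?g @ pword v r @ pword v q) e + ?T (closed_sum v ys)"
        by (simp add: er distrib_left distrib_right)
      from T[OF r] show ?case
      proof (elim disjE exE conjE)
        fix r' assume r': "closed_path_at E v r'" "weq N (?g @ pword v r @ pword v q) (pword v r')"
        have "?T (closed_sum v (er # ys)) - closed_sum v ((e, r') # zs) \<in> N"
          unfolding step using N_add[OF N_single_diff[OF r'(2), of e] zs(3)] by (simp add: algebra_simps)
        then show ?thesis using zs(1,2) r'(1) by (intro exI[of _ "(e, r') # zs"]) simp
      next
        assume null: "wnull N (?g @ pword v r @ pword v q)"
        have "?T (closed_sum v (er # ys)) - closed_sum v zs \<in> N"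
          unfolding step using N_add[OF N_single[OF null, of e] zs(3)] by (simp add: algebra_simps)
        then show ?thesis using zs(1,2) by (intro exI[of _ zs]) auto
      qed
    qed
    obtain zs where zs: "length zs \<le> length xs'" "\<forall>(d, p)\<in>set zs. closed_path_at E v p"
      "?T (closed_sum v xs') - closed_sum v zs \<in> N" using rest[OF xs'] by blast
    have null_p: "wnull N (?g @ pword v p @ pword v q)"
    proof -
      have pw: "awalk v p v" using p by (simp add: closed_path_at_def)
      have "awalk v (p @ q) v" using pw qw by (rule awalk_appendI)
      then have "ends_at v (p @ q)" unfolding ends_at_def by blast
      from corner_path[OF this qE] have "wnull N (?g @ pword v (p @ q))" using q(2) unfolding prefix_def by force
      then show ?thesis using weq_wnull[OF T_word[of p]] pw by auto
    qed
    have v_v: "weq N (?g @ [Vertex v] @ pword v q) [Vertex v]"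
    proof -
      have "ends_at v q" using qw by (auto simp: ends_at_def)
      from corner_path[OF this qE order_refl] have "weq N (?g @ pword v q) [Vertex v]" using v by (auto simp: awalk_Nil_iff)
      then show ?thesis using weq_trans[OF T_word[of "[]"]] by simp
    qed
    have "?T (Poly_Mapping.single [Vertex v] c + closed_sum v xs) - (Poly_Mapping.single [Vertex v] c + closed_sum v zs) =
        (Poly_Mapping.single (?g @ [Vertex v] @ pword v q) c - Poly_Mapping.single [Vertex v] c) +
        (Poly_Mapping.single (?g @ pword v p @ pword v q) d + (?T (closed_sum v xs') - closed_sum v zs))"
      by (simp add: Cons dp distrib_left distrib_right)
    also have "\<dots> \<in> N" by (intro N_add N_single_diff[OF v_v] N_single[OF null_p] zs(3))
    finally have 1: "?T (Poly_Mapping.single [Vertex v] c + closed_sum v xs) -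
        (Poly_Mapping.single [Vertex v] c + closed_sum v zs) \<in> S" using S(2) by blast
    have "?T (Poly_Mapping.single [Vertex v] c + closed_sum v xs) \<in> S"
      using v qE by (intro free_ideal_word_rmult[OF S(1)] free_ideal_word_lmult[OF S(1) less.prems(2)]) auto
    from free_ideal_transfer'[OF S(1) 1 this] show ?thesis
      using zs(1,2) by (intro less.hyps[of zs]) (auto simp: Cons)
  qed
qed

text \<open>
  If \<open>x\<close> were not in the graded core of \<open>S\<close>, some combination \<open>y\<close> of paths ending at a vertex
  \<open>v\<close> would be in \<open>S\<close> but not in the core; but \<open>v\<close> is in \<open>S\<close>, hence in the core because it is
  homogeneous, and \<open>y\<close> is congruent to \<open>y v\<close>.
\<close>

theorem condition_K_imp_homogeneous:
  assumes K: "condition_K E" and S: "free_ideal X S" "N \<subseteq> S" and x: "x \<in> S"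
  shows "hpart n x \<in> S"
proof -
  have "x \<in> graded_core S"
  proof (rule ccontr)
    assume "x \<notin> graded_core S"
    from exists_path_comb[OF S x this] obtain v y where
      v: "v \<in> verts E" and y: "y \<in> path_combs v" "y \<in> S" "y \<notin> graded_core S" by blast
    note J = free_ideal_graded_core[OF S(1)]
    have "y \<noteq> 0" using y(3) free_ideal_zero[OF J] by auto
    from path_comb_to_closed_sum[OF S y(1,2) this v] obtain c xs where
      "c \<noteq> 0" "\<forall>(d, p)\<in>set xs. closed_path_at E v p" "Poly_Mapping.single [Vertex v] c + closed_sum v xs \<in> S" by blast
    from vertex_in_if_closed_sum[OF K S v this] have vJ: "word [Vertex v] \<in> graded_core S"
      by (auto simp: graded_core_def free_ideal_zero[OF S(1)])
    have "y * word [Vertex v] - y \<in> N"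
    proof (rule poly_mapping_span_induct[of _ y])
      fix w c assume "w \<in> Poly_Mapping.keys y"
      then obtain p where p: "w = pword v p" "ends_at v p" using y(1) by (auto simp: path_combs_def)
      have "weq N (w @ [Vertex v]) w"
        using weq_context[OF weq_VV[OF v], of "map Edge p" "[]"] ends_atD[OF p(2)] by (simp add: p(1))
      from N_single_diff[OF this, of c]
      show "Poly_Mapping.single w c * word [Vertex v] - Poly_Mapping.single w c \<in> N" by simp
    next
      fix f g assume "f * word [Vertex v] - f \<in> N" "g * word [Vertex v] - g \<in> N"
      from N_add[OF this] show "(f + g) * word [Vertex v] - (f + g) \<in> N" by (simp add: algebra_simps)
    qed (simp add: N_zero)
    then have "y - y * word [Vertex v] \<in> graded_core S" using N_sym N_subset_core[OF S] by blast
    moreover have "y * word [Vertex v] \<in> graded_core S"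
      using path_combs_F[OF y(1) v] by (rule free_ideal_lmult[OF J vJ])
    ultimately show False using free_ideal_transfer[OF J] y(3) by blast
  qed
  then show ?thesis by (simp add: graded_core_def)
qed

section \<open>The action on infinite paths\<close>

text \<open>
  Each generator acts on infinite paths as a partial map, where \<open>None\<close> represents the zero
  vector.
\<close>

primrec gen_act :: "('a, 'b) lpa_gen \<Rightarrow> (nat \<Rightarrow> 'b) \<Rightarrow> (nat \<Rightarrow> 'b) option" where
  "gen_act (Vertex u) r = (if tail E (r 0) = u then Some r else None)"
| "gen_act (Edge e) r = (if head E e = tail E (r 0) then Some (case_nat e r) else None)"
| "gen_act (Ghost e) r = (if r 0 = e then Some (\<lambda>n. r (Suc n)) else None)"

primrec act :: "('a, 'b) lpa_gen list \<Rightarrow> (nat \<Rightarrow> 'b) \<Rightarrow> (nat \<Rightarrow> 'b) option" where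
  "act [] r = Some r"
| "act (g # w) r = Option.bind (act w r) (gen_act g)"

lemma act_append: "act (u @ w) r = Option.bind (act w r) (act u)"
  by (induction u) (cases "act w r"; simp)+

definition act_val :: "('a, 'b) lpa_gen list \<Rightarrow> ((nat \<Rightarrow> 'b) \<Rightarrow> 'k) \<Rightarrow> (nat \<Rightarrow> 'b) \<Rightarrow> 'k" where
  "act_val w x r = (case act w r of None \<Rightarrow> 0 | Some q \<Rightarrow> x q)"

text \<open>
  Functions on infinite paths form the dual of the module spanned by infinite paths. On functions,
  the action needs a single sum over the words of \<open>f\<close>; the price is that it is a right action
  (\<open>dual_act_mult\<close>).
\<close>

definition dual_act ::
    "(('a, 'b) lpa_gen list \<Rightarrow>\<^sub>0 'k) \<Rightarrow> ((nat \<Rightarrow> 'b) \<Rightarrow> 'k) \<Rightarrow> (nat \<Rightarrow> 'b) \<Rightarrow> 'k" where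
  "dual_act f x r = (\<Sum>w\<in>Poly_Mapping.keys f. Poly_Mapping.lookup f w * act_val w x r)"

lemma dual_act_add: "dual_act (f + g) x r = dual_act f x r + dual_act g x r"
  unfolding dual_act_def by (rule setsum_keys_plus_distrib) (simp_all add: distrib_right)

lemma dual_act_single [simp]: "dual_act (Poly_Mapping.single w c) x r = c * act_val w x r"
  by (cases "c = 0") (simp_all add: dual_act_def)

lemma dual_act_zero [simp]: "dual_act 0 x r = 0"
  by (simp add: dual_act_def)

lemma dual_act_diff: "dual_act (f - g) x r = dual_act f x r - dual_act g x r"
  using dual_act_add[of "f - g" g x r] by simp

lemma dual_act_sum: "dual_act (sum f A) x r = (\<Sum>i\<in>A. dual_act (f i) x r)"
  by (induction A rule: infinite_finite_induct) (simp_all add: dual_act_add)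

lemma act_val_add: "act_val w (\<lambda>s. x s + y s) r = act_val w x r + act_val w y r"
  by (simp add: act_val_def split: option.split)

lemma dual_act_add_right: "dual_act f (\<lambda>s. x s + y s) r = dual_act f x r + dual_act f y r"
  by (simp add: dual_act_def act_val_add distrib_left sum.distrib)

lemma act_val_scale: "act_val w (\<lambda>s. k * x s) r = k * act_val w x r"
  by (simp add: act_val_def split: option.split)

lemma dual_act_scale_right: "dual_act f (\<lambda>s. k * x s) r = k * dual_act f x r"
  by (simp add: dual_act_def act_val_scale sum_distrib_left mult.left_commute)

lemma dual_act_zero_right [simp]: "dual_act f (\<lambda>s. 0) r = 0"
  using dual_act_scale_right[of f 0 "\<lambda>s. 0" r] by simp

lemma dual_act_mult: "dual_act (f * g) x r = dual_act g (dual_act f x) r"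
proof (rule poly_mapping_span_induct[of _ f])
  have "dual_act 0 x = (\<lambda>s. 0)" by (simp add: fun_eq_iff)
  then show "dual_act (0 * g) x r = dual_act g (dual_act 0 x) r" by simp
  show "dual_act ((f + f') * g) x r = dual_act g (dual_act (f + f') x) r"
    if "dual_act (f * g) x r = dual_act g (dual_act f x) r" "dual_act (f' * g) x r = dual_act g (dual_act f' x) r"
    for f f'
  proof -
    have "dual_act (f + f') x = (\<lambda>s. dual_act f x s + dual_act f' x s)" by (simp add: dual_act_add fun_eq_iff)
    then show ?thesis using that by (simp add: distrib_right dual_act_add dual_act_add_right)
  qed
  fix u a
  show "dual_act (Poly_Mapping.single u a * g) x r = dual_act g (dual_act (Poly_Mapping.single u a) x) r"
  proof (rule poly_mapping_span_induct[of _ g])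
    fix w b
    show "dual_act (Poly_Mapping.single u a * Poly_Mapping.single w b) x r =
        dual_act (Poly_Mapping.single w b) (dual_act (Poly_Mapping.single u a) x) r"
      by (cases "act w r") (simp_all add: act_val_def act_append)
  qed (simp_all add: distrib_left dual_act_add)
qed

end

section \<open>A prime ideal that is not graded\<close>

text \<open>
  The situation in a graph that violates condition (K). Different edges of \<open>c\<close> have
  different sources, so \<open>c\<close> runs around a cycle, possibly several times.
\<close>

locale exclusive_cycle = leavitt E K for E :: "('a, 'b) pre_digraph" and K :: "'k::field itself" +
  fixes v :: 'a and c :: "'b list"
  assumes closed: "closed_path_at E v c"
    and inj_tail: "inj_on (tail E) (set c)"
    and exclusive: "\<And>q. closed_path_at E v q \<Longrightarrow> set q = set c"
begin

definition cyc :: "nat \<Rightarrow> 'b" where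
  "cyc n = c ! (n mod length c)"

definition inf_paths :: "(nat \<Rightarrow> 'b) set" where
  "inf_paths = {r. (\<forall>n. r n \<in> arcs E \<and> head E (r n) = tail E (r (Suc n))) \<and> (\<exists>m. \<forall>n. r (n + m) = cyc n)}"

lemma c_nonempty: "c \<noteq> []" and c_walk: "awalk v c v"
  using closed by (auto simp: closed_path_at_def)

lemma awalk_nth:
  assumes "awalk u p w" "i < length p"
  shows "head E (p ! i) = (if Suc i < length p then tail E (p ! Suc i) else w)"
  using assms
proof (induction p arbitrary: u i)
  case (Cons e p)
  show ?case
  proof (cases i)
    case 0
    then show ?thesis using Cons.prems by (cases p) (auto simp: awalk_Cons_iff awalk_Nil_iff)
  next
    case (Suc j)
    then show ?thesis using Cons.prems Cons.IH[of "head E e" j] by (auto simp: awalk_Cons_iff)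
  qed
qed simp

lemma tail_cyc_0: "tail E (cyc 0) = v"
proof -
  have "awalk v (hd c # tl c) v" using c_nonempty c_walk by simp
  then show ?thesis using c_nonempty by (simp add: awalk_Cons_iff cyc_def hd_conv_nth)
qed

lemma cyc_in_c: "cyc n \<in> set c"
  using c_nonempty by (simp add: cyc_def)

lemma cyc_periodic: "cyc (n + length c * t) = cyc n"
  by (simp add: cyc_def)

lemma cyc_path: "cyc n \<in> arcs E" "head E (cyc n) = tail E (cyc (Suc n))"
proof -
  show "cyc n \<in> arcs E" using cyc_in_c c_walk by blast
  let ?i = "n mod length c"
  have i: "?i < length c" using c_nonempty by simp
  show "head E (cyc n) = tail E (cyc (Suc n))"
  proof (cases "Suc ?i < length c")
    case True
    then have "Suc n mod length c = Suc ?i" by (simp add: mod_Suc)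
    then show ?thesis using awalk_nth[OF c_walk i] True by (simp add: cyc_def)
  next
    case False
    then have "Suc ?i = length c" using i by simp
    then have "Suc n mod length c = 0" by (simp add: mod_Suc)
    then have "cyc (Suc n) = cyc 0" by (simp add: cyc_def)
    then show ?thesis using awalk_nth[OF c_walk i] False tail_cyc_0 by (simp add: cyc_def)
  qed
qed

lemma cyc_in_inf_paths: "cyc \<in> inf_paths"
  using cyc_path by (auto simp: inf_paths_def intro: exI[of _ 0])

lemma inf_paths_prefix_walk:
  assumes "\<And>n. r n \<in> arcs E \<and> head E (r n) = tail E (r (Suc n))"
  shows "awalk (tail E (r 0)) (map r [0..<m]) (tail E (r m))"
proof (induction m)
  case 0
  then show ?case using assms[of 0] by (simp add: awalk_Nil_iff)
next
  case (Suc m)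
  have "awalk (tail E (r m)) [r m] (tail E (r (Suc m)))" using assms[of m] assms[of "Suc m"] by (simp add: awalk_simps)
  with Suc show ?case by (auto intro: awalk_appendI)
qed

text \<open>
  The initial part of \<open>r\<close>, up to the point where \<open>r\<close> agrees with the cycle, is a closed path at
  \<open>v\<close> and therefore uses only edges of \<open>c\<close>; and among these edges, at most one
  starts at any given vertex.
\<close>

lemma inf_path_from_v:
  assumes r: "r \<in> inf_paths" "tail E (r 0) = v"
  shows "r = cyc"
proof -
  have path: "r n \<in> arcs E \<and> head E (r n) = tail E (r (Suc n))" for n using r(1) by (simp add: inf_paths_def)
  obtain m where m: "\<And>n. r (n + m) = cyc n" using r(1) by (auto simp: inf_paths_def)
  have "r n \<in> set c" for n
  proof (cases "n < m")
    case True
    have "tail E (r m) = v" using m[of 0] tail_cyc_0 by simp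
    then have "closed_path_at E v (map r [0..<m])"
      using True inf_paths_prefix_walk[of r m, OF path] r(2) by (auto simp: closed_path_at_def)
    from exclusive[OF this] show ?thesis using True by (metis atLeastLessThan_iff image_eqI le0 set_map set_upt)
  next
    case False
    then show ?thesis using m[of "n - m"] cyc_in_c by simp
  qed
  moreover have "r n = cyc n" if "\<And>n. r n \<in> set c" for n
  proof (induction n)
    case 0
    show ?case using inj_onD[OF inj_tail _ that cyc_in_c] r(2) tail_cyc_0 by simp
  next
    case (Suc n)
    have "tail E (r (Suc n)) = tail E (cyc (Suc n))" using path[of n] cyc_path(2)[of n] Suc by simp
    then show ?case using inj_onD[OF inj_tail _ that cyc_in_c] by blast
  qed
  ultimately show ?thesis by blast
qed

lemma gen_act_inf_paths:
  assumes "g \<in> X" "r \<in> inf_paths" "gen_act g r = Some q"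
  shows "q \<in> inf_paths"
proof -
  have path: "r n \<in> arcs E \<and> head E (r n) = tail E (r (Suc n))" for n using assms(2) by (simp add: inf_paths_def)
  obtain m where m: "\<And>n. r (n + m) = cyc n" using assms(2) by (auto simp: inf_paths_def)
  show ?thesis
  proof (cases g)
    case (Vertex u)
    then show ?thesis using assms by (auto split: if_splits)
  next
    case (Edge e)
    then have "q = case_nat e r" "head E e = tail E (r 0)" "e \<in> arcs E" using assms by (auto split: if_splits)
    then have "q n \<in> arcs E \<and> head E (q n) = tail E (q (Suc n))" "q (n + Suc m) = cyc n" for n
      using m path by (auto split: nat.split)
    then show ?thesis unfolding inf_paths_def by blast
  next
    case (Ghost e)
    then have q: "q = (\<lambda>n. r (Suc n))" using assms by (auto split: if_splits)
    have "r (Suc (n + (m + length c - 1))) = cyc n" for n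
    proof -
      have "Suc (n + (m + length c - 1)) = (n + length c * 1) + m" using c_nonempty by (cases c) auto
      then show ?thesis using m cyc_periodic by metis
    qed
    then show ?thesis using path by (auto simp: inf_paths_def q)
  qed
qed

lemma act_inf_paths: "set w \<subseteq> X \<Longrightarrow> r \<in> inf_paths \<Longrightarrow> act w r = Some q \<Longrightarrow> q \<in> inf_paths"
  by (induction w arbitrary: q) (auto simp: bind_eq_Some_conv intro: gen_act_inf_paths)

definition annih :: "(('a, 'b) lpa_gen list \<Rightarrow>\<^sub>0 'k) set" where
  "annih = {f \<in> F. \<forall>x. \<forall>r\<in>inf_paths. dual_act f x r = 0}"

lemma free_ideal_annih: "free_ideal X annih"
  unfolding free_ideal_def
proof (intro conjI ballI)
  show "annih \<subseteq> F" "0 \<in> annih" by (auto simp: annih_def)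
  show "f - g \<in> annih" if "f \<in> annih" "g \<in> annih" for f g
    using that by (simp add: annih_def dual_act_diff)
  fix f g assume f: "f \<in> annih" and g: "g \<in> F"
  then show "g * f \<in> annih" by (simp add: annih_def dual_act_mult)
  have "dual_act g (dual_act f x) r = 0" if r: "r \<in> inf_paths" for x r
  proof -
    have "act_val w (dual_act f x) r = 0" if "w \<in> Poly_Mapping.keys g" for w
    proof -
      have "set w \<subseteq> X" using that g by (auto simp: carrier_free_alg)
      then show ?thesis using act_inf_paths[OF _ r] f
        by (auto simp: act_val_def annih_def split: option.split)
    qed
    then show ?thesis by (simp add: dual_act_def[of g])
  qed
  then show "f * g \<in> annih" using f g by (simp add: annih_def dual_act_mult)
qed

text \<open>
  The action respects the defining relations. For the last one: an infinite path that starts at a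
  regular vertex begins with exactly one of the edges that leave this vertex.
\<close>

lemma N_subset_annih: "N \<subseteq> annih"
proof (rule N_minimal[OF free_ideal_annih])
  show "Poly_Mapping.single [] k * f \<in> annih" if "f \<in> annih" for f k
    using that by (simp add: annih_def dual_act_mult)
  show "lpa_relations E \<subseteq> annih"
  proof
    fix f :: "('a, 'b) lpa_gen list \<Rightarrow>\<^sub>0 'k" assume f: "f \<in> lpa_relations E"
    have "dual_act f x r = 0" if r: "r \<in> inf_paths" for x r
    proof -
      have path: "r n \<in> arcs E" "head E (r n) = tail E (r (Suc n))" for n using r by (simp_all add: inf_paths_def)
      have shift: "case_nat (r 0) (\<lambda>n. r (Suc n)) = r" by (auto simp: fun_eq_iff split: nat.split)
      from f show ?thesis
      proof cases
        case (CK2 u)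
        have "dual_act f x r = act_val [Vertex u] x r - (\<Sum>e\<in>out_arcs E u. act_val [Edge e, Ghost e] x r)"
          by (simp add: CK2(1) dual_act_diff dual_act_sum)
        moreover have "act_val [Edge e, Ghost e] x r = (if r 0 = e then x r else 0)" for e
          using path(2)[of 0] shift by (auto simp: act_val_def)
        moreover have "(\<Sum>e\<in>out_arcs E u. if r 0 = e then x r else 0) = act_val [Vertex u] x r"
          using CK2(2) path(1)[of 0] by (simp add: regular_vertex_def act_val_def)
        ultimately show ?thesis by simp
      qed (use path(2)[of 0] in \<open>auto simp: dual_act_diff act_val_def\<close>)
    qed
    then show "f \<in> annih" using f relations_in_F by (auto simp: annih_def)
  qed
qed

lemma act_edges: 
  assumes "\<And>n. r n \<in> arcs E \<and> head E (r n) = tail E (r (Suc n))"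
  shows "act (map Edge (map r [0..<m])) (\<lambda>n. r (n + m)) = Some r"
proof -
  have "act (map Edge (map r [i..<m])) (\<lambda>n. r (n + m)) = Some (\<lambda>n. r (n + i))" if "i \<le> m" for i
    using that
  proof (induction rule: inc_induct)
    case (step i)
    have "case_nat (r i) (\<lambda>n. r (n + Suc i)) = (\<lambda>n. r (n + i))" by (auto simp: fun_eq_iff split: nat.split)
    then show ?case using step assms[of i] by (simp add: upt_conv_Cons)
  qed simp
  from this[of 0] show ?thesis by simp
qed

lemma act_ghosts:
  "act (map Ghost (rev (map r [0..<m]))) q = (if \<forall>i<m. q i = r i then Some (\<lambda>n. q (n + m)) else None)"
proof (induction m)
  case (Suc m)
  have "map Ghost (rev (map r [0..<Suc m])) = Ghost (r m) # map Ghost (rev (map r [0..<m]))" by simp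
  then show ?case using Suc by (auto simp: less_Suc_eq)
qed simp

lemma cycle_minus_vertex_in_annih: "word (map Edge c) - word [Vertex v] \<in> annih"
proof -
  have "act_val (map Edge c) x r = act_val [Vertex v] x r" if r: "r \<in> inf_paths" for x r
  proof (cases "tail E (r 0) = v")
    case True
    then have rc: "r = cyc" using inf_path_from_v r by blast
    have "map cyc [0..<length c] = c" by (rule nth_equalityI) (auto simp: cyc_def)
    moreover have "(\<lambda>n. cyc (n + length c)) = cyc" using cyc_periodic[of _ 1] by (simp add: fun_eq_iff)
    ultimately have "act (map Edge c) cyc = Some cyc" using act_edges[of cyc "length c"] cyc_path by simp
    then show ?thesis using tail_cyc_0 by (simp add: act_val_def rc)
  next
    case False
    obtain c' e where c: "c = c' @ [e]" using c_nonempty by (metis rev_exhaust)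
    then have "head E e = v" using c_walk by (auto simp: awalk_append_iff awalk_simps)
    then show ?thesis using False by (auto simp: act_val_def c act_append)
  qed
  moreover have "set c \<subseteq> arcs E" "v \<in> verts E" using c_walk by auto
  ultimately show ?thesis using c_nonempty by (auto simp: annih_def dual_act_diff)
qed

lemma vertex_notin_annih: "word [Vertex v] \<notin> annih"
proof
  assume "word [Vertex v] \<in> annih"
  then have "dual_act (word [Vertex v]) (\<lambda>_. 1) cyc = 0" using cyc_in_inf_paths by (simp add: annih_def)
  then show False by (simp add: act_val_def tail_cyc_0)
qed

lemma annih_not_homogeneous: "\<exists>f\<in>annih. \<exists>n. hpart n f \<notin> annih"
proof -
  have "hpart 0 (word (map Edge c) - word [Vertex v]) = - word [Vertex v]"
    using c_nonempty by (simp add: hpart_diff)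
  moreover have "- word [Vertex v] \<notin> annih"
    using vertex_notin_annih free_ideal_uminus[OF free_ideal_annih, of "- word [Vertex v]"] by auto
  ultimately show ?thesis using cycle_minus_vertex_in_annih by metis
qed

text \<open>
  Some infinite path \<open>q\<close> occurs with a nonzero coefficient \<open>k\<close> in the image of some \<open>r\<close> under \<open>f\<close>.
  Removing a prefix of \<open>q\<close> that no other path in that image has, and that reaches the periodic part
  of \<open>q\<close>, leaves \<open>k\<close> times the periodic path; and \<open>r\<close> is itself obtained from the
  periodic path by prepending edges. So \<open>g\<close> can be chosen as \<open>f\<close> between two words.
\<close>

lemma isolate_cycle:
  assumes S: "free_ideal X S" and f: "f \<in> S" "f \<notin> annih"
  shows "\<exists>g\<in>S. \<exists>k. k \<noteq> 0 \<and> (\<forall>x. dual_act g x cyc = k * x cyc)"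
proof -
  have fF: "f \<in> F" using f(1) by (rule free_ideal_carrier[OF S])
  then obtain x r where r: "r \<in> inf_paths" and nz: "dual_act f x r \<noteq> 0" using f(2) by (auto simp: annih_def)
  \<comment> \<open>The finitely many infinite paths that can occur in the image of \<open>r\<close> under \<open>f\<close>.\<close>
  define A where "A = {q. \<exists>w\<in>Poly_Mapping.keys f. act w r = Some q}"
  have "A \<subseteq> (\<lambda>w. the (act w r)) ` Poly_Mapping.keys f" by (force simp: A_def)
  then have finA: "finite A" by (rule finite_subset) simp
  have A_paths: "q \<in> inf_paths" if "q \<in> A" for q
    using that act_inf_paths[OF _ r] fF by (auto simp: A_def carrier_free_alg)
  have cong: "dual_act f y r = dual_act f z r" if "\<And>q. q \<in> A \<Longrightarrow> y q = z q" for y z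
    unfolding dual_act_def using that
    by (intro sum.cong refl arg_cong2[of _ _ _ _ "(*)"]) (auto simp: act_val_def A_def split: option.split)
  have "\<exists>q\<in>A. dual_act f (\<lambda>s. if s = q then 1 else 0) r \<noteq> 0"
  proof (rule ccontr)
    assume 0: "\<not> ?thesis"
    have lin: "dual_act f (\<lambda>s. \<Sum>q\<in>B. x q * (if s = q then 1 else 0)) r = 0" if "finite B" "B \<subseteq> A" for B
      using that
    proof (induction rule: finite_induct)
      case empty
      then show ?case by simp
    next
      case (insert q B)
      then show ?case using 0 by (simp add: dual_act_add_right dual_act_scale_right)
    qed
    have "dual_act f x r = dual_act f (\<lambda>s. \<Sum>q\<in>A. x q * (if s = q then 1 else 0)) r"
      by (rule cong) (simp add: finA if_distrib cong: if_cong)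
    then show False using lin[OF finA] nz by simp
  qed
  then obtain q where q: "q \<in> A" and k: "dual_act f (\<lambda>s. if s = q then 1 else 0) r \<noteq> 0" by blast
  define k where "k = dual_act f (\<lambda>s. if s = q then 1 else 0) r"
  have "\<forall>s. \<exists>n. s \<noteq> q \<longrightarrow> s n \<noteq> q n" by (metis ext)
  then obtain d where d: "\<And>s. s \<noteq> q \<Longrightarrow> s (d s) \<noteq> q (d s)" by metis
  obtain m0 where m0: "\<And>n. q (n + m0) = cyc n" using A_paths[OF q] by (auto simp: inf_paths_def)
  \<comment> \<open>The prefix must separate \<open>q\<close> from the rest of \<open>A\<close> and its length must be \<open>m0\<close> plus a multiple of the period.\<close>
  define t where "t = Suc (Max (insert 0 (d ` A)))"
  define m where "m = m0 + length c * t"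
  have q_shift: "(\<lambda>n. q (n + m)) = cyc"
  proof
    fix n
    have "n + m = (n + length c * t) + m0" by (simp add: m_def)
    then show "q (n + m) = cyc n" by (simp only: m0 cyc_periodic)
  qed
  have d_less: "d s < m" if "s \<in> A" for s
  proof -
    have "d s \<le> Max (insert 0 (d ` A))" using that finA by (intro Max_ge) auto
    also have "\<dots> < t" by (simp add: t_def)
    also have "\<dots> \<le> length c * t" using c_nonempty by (cases c) auto
    finally show ?thesis by (simp add: m_def)
  qed
  let ?G = "map Ghost (rev (map q [0..<m]))"
  have G: "act_val ?G y s = y cyc * (if s = q then 1 else 0)" if "s \<in> A" for y s
  proof (cases "s = q")
    case True
    then show ?thesis using q_shift by (simp add: act_val_def act_ghosts)
  next
    case False
    then show ?thesis using d[OF False] d_less[OF that] by (auto simp: act_val_def act_ghosts)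
  qed
  have rp: "r n \<in> arcs E \<and> head E (r n) = tail E (r (Suc n))" for n using r by (simp add: inf_paths_def)
  obtain m' where m': "\<And>n. r (n + m') = cyc n" using r by (auto simp: inf_paths_def)
  let ?R = "map Edge (map r [0..<m'])"
  have R: "act ?R cyc = Some r" using act_edges[of r m', OF rp] m' by simp
  have "dual_act (word ?G * f * word ?R) y cyc = k * y cyc" for y
  proof -
    have "dual_act (word ?G * f * word ?R) y cyc = dual_act f (dual_act (word ?G) y) r"
      by (simp only: dual_act_mult dual_act_single act_val_def R option.case mult_1)
    also have "\<dots> = dual_act f (\<lambda>s. y cyc * (if s = q then 1 else 0)) r"
      by (rule cong) (simp only: dual_act_single G mult_1)
    also have "\<dots> = y cyc * k"
      unfolding k_def by (rule dual_act_scale_right)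
    finally show ?thesis by (simp add: mult.commute)
  qed
  moreover have "word ?G * f * word ?R \<in> S"
  proof -
    have "q n \<in> arcs E" for n using A_paths[OF q] by (simp add: inf_paths_def)
    then have "set ?G \<subseteq> X" by auto
    moreover have "set ?R \<subseteq> X" using rp by auto
    ultimately show ?thesis using f(1) by (intro free_ideal_word_rmult[OF S] free_ideal_word_lmult[OF S])
  qed
  ultimately show ?thesis using k unfolding k_def[symmetric] by blast
qed

lemma annih_prime:
  assumes "free_ideal X S" "\<not> S \<subseteq> annih" "free_ideal X S'" "\<not> S' \<subseteq> annih"
  shows "\<exists>f\<in>S. \<exists>g\<in>S'. f * g \<notin> annih"
proof -
  obtain f k where f: "f \<in> S" "k \<noteq> 0" "\<And>x. dual_act f x cyc = k * x cyc" using isolate_cycle assms(1,2) by blast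
  obtain g l where g: "g \<in> S'" "l \<noteq> 0" "\<And>x. dual_act g x cyc = l * x cyc" using isolate_cycle assms(3,4) by blast
  have "dual_act (f * g) (\<lambda>_. 1) cyc \<noteq> 0" using f g by (simp add: dual_act_mult)
  then have "f * g \<notin> annih" using cyc_in_inf_paths by (auto simp: annih_def)
  then show ?thesis using f g by blast
qed

lemma nongraded_prime: "\<exists>P. rng_prime_ideal P L \<and> \<not> lpa_graded E P"
proof (intro exI conjI)
  let ?P = "cl ` annih"
  have P: "rng_ideal ?P L" by (rule rng_ideal_cl_image[OF free_ideal_annih])
  have pull: "pull ?P = annih" by (rule pull_cl_image[OF free_ideal_annih N_subset_annih])
  show "\<not> lpa_graded E ?P"
    using annih_not_homogeneous by (auto simp: lpa_graded_iff[OF P] pull)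
  show "rng_prime_ideal ?P L"
    unfolding rng_prime_ideal_def
  proof (intro conjI allI impI P)
    have "word [Vertex v] \<in> F" using c_walk by auto
    then show "?P \<noteq> carrier L" using vertex_notin_annih pull by (auto simp: pull_def carrier_L)
    fix I J assume I: "rng_ideal I L" and J: "rng_ideal J L" and IJ: "I \<cdot>\<^bsub>L\<^esub> J \<subseteq> ?P"
    show "I \<subseteq> ?P \<or> J \<subseteq> ?P"
    proof (rule ccontr)
      assume not: "\<not> (I \<subseteq> ?P \<or> J \<subseteq> ?P)"
      have "I \<subseteq> ?P" if "pull I \<subseteq> annih"
        using image_mono[OF that, of cl] by (simp only: cl_image_pull[OF I])
      moreover have "J \<subseteq> ?P" if "pull J \<subseteq> annih"
        using image_mono[OF that, of cl] by (simp only: cl_image_pull[OF J])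
      ultimately have "\<not> pull I \<subseteq> annih" "\<not> pull J \<subseteq> annih" using not by auto
      from annih_prime[OF free_ideal_pull[OF I] this(1) free_ideal_pull[OF J] this(2)]
      obtain f g where fg: "f \<in> pull I" "g \<in> pull J" "f * g \<notin> annih" by blast
      then have "cl f \<otimes>\<^bsub>L\<^esub> cl g \<in> I \<cdot>\<^bsub>L\<^esub> J" by (intro ideal_prod.prod) (auto simp: pull_def)
      moreover have "f \<in> F" "g \<in> F" using fg by (auto simp: pull_def)
      ultimately have "f * g \<in> pull ?P" using IJ by (auto simp: pull_def mult_L)
      then show False using fg(3) pull by simp
    qed
  qed
qed

end

context leavitt
begin

text \<open>
  If two edges had the same source, the part between them could be cut out.
\<close>

lemma shortest_closed_path_inj:
  assumes c: "closed_path_at E v c" and min: "\<And>q. closed_path_at E v q \<Longrightarrow> length c \<le> length q"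
  shows "inj_on (tail E) (set c)"
proof -
  have cw: "awalk v c v" using c by (simp add: closed_path_at_def)
  have no: "tail E (c ! i) \<noteq> tail E (c ! j)" if ij: "i < j" "j < length c" for i j
  proof
    assume eq: "tail E (c ! i) = tail E (c ! j)"
    have split: "awalk v (take i c) (tail E (c ! i)) \<and> awalk (tail E (c ! i)) (drop i c) v" if "i < length c" for i
    proof -
      have "awalk v (take i c @ drop i c) v" using cw by simp
      then have *: "awalk v (take i c) (awlast v (take i c)) \<and> awalk (awlast v (take i c)) (drop i c) v"
        by (simp only: awalk_append_iff)
      moreover have "drop i c = c ! i # drop (Suc i) c" using that by (simp add: Cons_nth_drop_Suc)
      ultimately have "awlast v (take i c) = tail E (c ! i)" by (simp only: awalk_Cons_iff)
      then show ?thesis using * by simp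
    qed
    have "awalk v (take i c @ drop j c) v"
      using split[of i] split[of j] ij eq by (auto intro: awalk_appendI)
    then have "closed_path_at E v (take i c @ drop j c)" using ij by (simp add: closed_path_at_def)
    from min[OF this] show False using ij by simp
  qed
  show ?thesis
    by (rule inj_onI) (metis in_set_conv_nth linorder_neqE_nat no)
qed

text \<open>
  The violating closed path may start at another vertex \<open>u\<close>; rotating it gives a closed path at
  \<open>v\<close>. All closed paths at \<open>v\<close> have the same set of edges, and a shortest one will do.
\<close>

lemma not_condition_K_cycle:
  assumes "\<not> condition_K E"
  shows "\<exists>v c. exclusive_cycle E v c"
proof -
  obtain u p v where p: "closed_path_at E u p" and v: "v \<in> set (awalk_verts u p)"
    and all: "\<And>q. closed_path_at E v q \<Longrightarrow> set q = set p"
    using assms unfolding condition_K_def by blast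
  have "awalk u p u" "p \<noteq> []" using p by (auto simp: closed_path_at_def)
  then obtain q r where "p = q @ r" "awalk u q v" "awalk v r u" using awalk_decomp[OF _ v] by blast
  then have "closed_path_at E v (r @ q)" using \<open>p \<noteq> []\<close> by (auto simp: closed_path_at_def intro: awalk_appendI)
  then obtain c where c: "closed_path_at E v c" "\<And>q. closed_path_at E v q \<Longrightarrow> length c \<le> length q"
    using ex_has_least_nat[of "closed_path_at E v" _ length] by blast
  have "exclusive_cycle E v c"
    using c all shortest_closed_path_inj[OF c] by unfold_locales auto
  then show ?thesis by blast
qed

lemma prime_graded_imp_condition_K:
  assumes "\<And>P. rng_prime_ideal P L \<Longrightarrow> lpa_graded E P"
  shows "condition_K E"
proof (rule ccontr)
  assume "\<not> condition_K E"
  then obtain v c where "exclusive_cycle E v c" using not_condition_K_cycle by blast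
  then interpret exclusive_cycle E K v c .
  show False using nongraded_prime assms by blast
qed

end

section \<open>Completely irreducible ideals and the equivalence\<close>

lemma free_ideal_Union_chain:
  fixes \<C> :: "('g list \<Rightarrow>\<^sub>0 'k::field) set set"
  assumes "\<C> \<noteq> {}" "subset.chain \<A> \<C>" "\<And>S. S \<in> \<C> \<Longrightarrow> free_ideal X S"
  shows "free_ideal X (\<Union>\<C>)"
  unfolding free_ideal_def
proof (intro conjI ballI)
  show "\<Union>\<C> \<subseteq> carrier (free_alg X)" using assms(3) free_ideal_carrier by blast
  show "0 \<in> \<Union>\<C>" using assms(1,3) free_ideal_zero by blast
  show "f - g \<in> \<Union>\<C>" if "f \<in> \<Union>\<C>" "g \<in> \<Union>\<C>" for f g
  proof -
    from that obtain S T where "S \<in> \<C>" "f \<in> S" "T \<in> \<C>" "g \<in> T" by blast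
    moreover from this have "S \<subseteq> T \<or> T \<subseteq> S" using assms(2) by (auto simp: subset.chain_def)
    ultimately obtain U where "U \<in> \<C>" "f \<in> U" "g \<in> U" by blast
    then show ?thesis using free_ideal_diff[OF assms(3)] by blast
  qed
  fix f g :: "'g list \<Rightarrow>\<^sub>0 'k"
  assume "f \<in> \<Union>\<C>" "g \<in> carrier (free_alg X)"
  then obtain S where "S \<in> \<C>" "f \<in> S" by blast
  with \<open>g \<in> carrier (free_alg X)\<close> show "g * f \<in> \<Union>\<C>" "f * g \<in> \<Union>\<C>"
    using free_ideal_lmult[OF assms(3)] free_ideal_rmult[OF assms(3)] by blast+
qed

context leavitt
begin

text \<open>
  The element \<open>a\<close> lies in every ideal that properly contains \<open>S\<close>, hence in the intersection of
  any set of such ideals.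
\<close>

lemma maximal_avoiding_imp_completely_irreducible:
  assumes S: "free_ideal X S" "N \<subseteq> S" and a: "a \<in> F" "a \<notin> S"
    and max: "\<And>T. free_ideal X T \<Longrightarrow> S \<subset> T \<Longrightarrow> a \<in> T"
  shows "completely_irreducible_ideal (cl ` S) L"
proof -
  have I: "rng_ideal (cl ` S) L" by (rule rng_ideal_cl_image[OF S(1)])
  have pull: "pull (cl ` S) = S" by (rule pull_cl_image[OF S])
  have clF: "cl a \<in> carrier L" using a(1) by (simp add: carrier_L)
  have cla: "cl a \<notin> cl ` S" using a pull by (auto simp: pull_def)
  show ?thesis
    unfolding completely_irreducible_ideal_def
  proof (intro conjI notI I)
    assume "cl ` S = carrier L"
    then show False using clF cla by simp
  next
    assume "\<exists>\<S>. (\<forall>J\<in>\<S>. rng_ideal J L \<and> cl ` S \<subset> J) \<and> cl ` S = carrier L \<inter> \<Inter>\<S>"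
    then obtain \<S> where "(\<forall>J\<in>\<S>. rng_ideal J L \<and> cl ` S \<subset> J) \<and> cl ` S = carrier L \<inter> \<Inter>\<S>" ..
    then have J: "\<forall>J\<in>\<S>. rng_ideal J L \<and> cl ` S \<subset> J" and eq: "cl ` S = carrier L \<inter> \<Inter>\<S>"
      by (rule conjunct1, rule conjunct2)
    have "cl a \<in> J" if "J \<in> \<S>" for J
    proof -
      have J': "rng_ideal J L" "cl ` S \<subset> J" using bspec[OF J that] by simp_all
      have "S \<subseteq> pull J" using J'(2) free_ideal_carrier[OF S(1)] by (auto simp: pull_def)
      moreover have "S \<noteq> pull J" using J'(2) cl_image_pull[OF J'(1)] by auto
      ultimately have "a \<in> pull J" using max[OF free_ideal_pull[OF J'(1)]] by blast
      then show ?thesis by (simp add: pull_def)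
    qed
    then have "cl a \<in> carrier L \<inter> \<Inter>\<S>" using clF by simp
    with cla show False unfolding eq by (rule notE)
  qed
qed

lemma completely_irreducible_graded_imp_graded:
  assumes CI: "\<And>I. completely_irreducible_ideal I L \<Longrightarrow> lpa_graded E I" and I: "rng_ideal I L"
  shows "lpa_graded E I"
  unfolding lpa_graded_iff[OF I]
proof (intro ballI allI, rule ccontr)
  fix f n assume f: "f \<in> pull I" and a: "hpart n f \<notin> pull I"
  define \<A> where "\<A> = {S. free_ideal X S \<and> pull I \<subseteq> S \<and> hpart n f \<notin> S}"
  have "pull I \<in> \<A>" using a free_ideal_pull[OF I] by (simp add: \<A>_def)
  moreover have "\<Union>\<C> \<in> \<A>" if \<C>: "\<C> \<noteq> {}" "subset.chain \<A> \<C>" for \<C>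
  proof -
    have sub: "\<C> \<subseteq> \<A>" using \<C>(2) by (simp add: subset.chain_def)
    then have "free_ideal X (\<Union>\<C>)" by (intro free_ideal_Union_chain[OF \<C>]) (auto simp: \<A>_def)
    then show ?thesis using sub \<C>(1) by (auto simp: \<A>_def)
  qed
  ultimately obtain S where "S \<in> \<A>" and max: "\<And>T. T \<in> \<A> \<Longrightarrow> S \<subseteq> T \<Longrightarrow> T = S"
    using subset_Zorn_nonempty[of \<A>] by blast
  then have S: "free_ideal X S" "pull I \<subseteq> S" "hpart n f \<notin> S" by (auto simp: \<A>_def)
  have N: "N \<subseteq> S" using N_subset_pull[OF I] S(2) by blast
  have fF: "hpart n f \<in> F" using f by (simp add: pull_def)
  have "hpart n f \<in> T" if T: "free_ideal X T" "S \<subset> T" for T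
  proof (rule ccontr)
    assume "hpart n f \<notin> T"
    then have "T \<in> \<A>" using T S(2) by (auto simp: \<A>_def)
    then show False using max T(2) by blast
  qed
  then have "lpa_graded E (cl ` S)"
    using maximal_avoiding_imp_completely_irreducible[OF S(1) N fF S(3)] by (intro CI) blast
  then have "hpart n f \<in> S"
    using f S(2) by (auto simp: lpa_graded_iff[OF rng_ideal_cl_image[OF S(1)]] pull_cl_image[OF S(1) N])
  then show False using S(3) by simp
qed

lemma condition_K_imp_graded:
  assumes "condition_K E" "rng_ideal I L"
  shows "lpa_graded E I"
  unfolding lpa_graded_iff[OF assms(2)]
  using condition_K_imp_homogeneous[OF assms(1) free_ideal_pull[OF assms(2)] N_subset_pull[OF assms(2)]] by blast

end

theorem proposition5p10:
  fixes E :: "('a, 'b) pre_digraph"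
    and L :: "('k::field, (('a, 'b) lpa_gen list \<Rightarrow>\<^sub>0 'k) set) module"
  assumes "wf_digraph E" and "verts E \<noteq> {}"
    and "L = leavitt_path_algebra E"
  shows "((\<forall>I. completely_irreducible_ideal I L \<longrightarrow> lpa_graded E I) \<longleftrightarrow>
          (\<forall>I. rng_prime_ideal I L \<longrightarrow> lpa_graded E I))
       \<and> ((\<forall>I. rng_prime_ideal I L \<longrightarrow> lpa_graded E I) \<longleftrightarrow>
          (\<forall>I. rng_ideal I L \<longrightarrow> lpa_graded E I))
       \<and> ((\<forall>I. rng_ideal I L \<longrightarrow> lpa_graded E I) \<longleftrightarrow> condition_K E)"
proof -
  interpret leavitt E "TYPE('k)" using assms(1) by (simp add: leavitt_def)
  have "\<forall>I. rng_ideal I L \<longrightarrow> lpa_graded E I" if "\<forall>I. completely_irreducible_ideal I L \<longrightarrow> lpa_graded E I"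
    using that completely_irreducible_graded_imp_graded unfolding assms(3) by blast
  moreover have "\<forall>I. completely_irreducible_ideal I L \<longrightarrow> lpa_graded E I" if "\<forall>I. rng_ideal I L \<longrightarrow> lpa_graded E I"
    using that by (simp add: completely_irreducible_ideal_def)
  moreover have "\<forall>I. rng_prime_ideal I L \<longrightarrow> lpa_graded E I" if "\<forall>I. rng_ideal I L \<longrightarrow> lpa_graded E I"
    using that by (simp add: rng_prime_ideal_def)
  moreover have "condition_K E" if "\<forall>I. rng_prime_ideal I L \<longrightarrow> lpa_graded E I"
    using that prime_graded_imp_condition_K unfolding assms(3) by blast
  moreover have "\<forall>I. rng_ideal I L \<longrightarrow> lpa_graded E I" if "condition_K E"
    using that condition_K_imp_graded unfolding assms(3) by blast
  ultimately show ?thesis by argo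
qed

end
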